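(* Let $\mathbb F$ be a field of characteristic different from $2$. (1) Let $A$ be a commutative associative $\mathbb F$-algebra with product $\pi$. If $\pi+h\pi_1$ is an infinitesimal deformation of $A$ which extends to a second order deformation, then the antisymmetric part $\pi_1^-$ of $\pi_1$ is an antisymmetric biderivation which satisfies the Jacobi identity $$\pi_1^-(\pi_1^-(p,q),r)+\pi_1^-(\pi_1^-(q,r),p)+\pi_1^-(\pi_1^-(r,p),q)=0\qquad (p,q,r\in A),$$ so that $\pi_1^-$ determines a Poisson algebra structure on $A$. (2) If $A$ is a polynomial algebra over $\mathbb F$, then the converse is true. More precisely, if $\pi+h\pi_1$ is an infinitesimal deformation of $A$ such that $\pi_1^-$ satisfies the Jacobi identity displayed in (1), then the infinitesimal deformation extends to a second order deformation $\pi+h\pi_1+h^2\pi_2$. Furthermore, if $\pi_1$ is antisymmetric then $\pi_2$ can be chosen to be symmetric, in which case the deformation can be extended to order $3$. In particular, any Poisson algebra structure $\{\cdot,\cdot\}$ on a polynomial algebra $A$ determines a deformation quantization of $A$ of order $3$ (with $\pi_1=\frac12\{\cdot,\cdot\}$).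
   Context: For a commutative associative algebra $A$ over $\mathbb F$ with product $\pi(p,q)=pq$, a 2-cochain is an $\mathbb F$-bilinear map $A\times A\to A$. An $n$-th order deformation of $A$ is given by 2-cochains $\pi_1,\dots,\pi_n$ such that the $\mathbb F[[h]]$-bilinear product $\pi+h\pi_1+\cdots+h^n\pi_n$ on $A[[h]]$ is associative modulo $h^{n+1}$. An infinitesimal deformation is a first order deformation. A deformation extends to order $m>n$ if there are 2-cochains $\pi_{n+1},\dots,\pi_m$ such that $\pi+h\pi_1+\cdots+h^m\pi_m$ is an $m$-th order deformation. An $n$-th order deformation is a deformation quantization (of order $n$) if $\pi_k$ is symmetric for $k$ even and antisymmetric for $k$ odd ($1\le k\le n$). Every 2-cochain $\varphi$ decomposes uniquely as $\varphi=\varphi^++\varphi^-$ with $\varphi^+$ symmetric and $\varphi^-$ antisymmetric. A Poisson bracket on $A$ is an antisymmetric biderivation $\{\cdot,\cdot\}:A\times A\to A$ satisfying the Jacobi identity. A polynomial algebra is an algebra $\mathbb F[x_i]_{i\in\mathcal I}$ (any number of variables). *)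

theory Defs
  imports
    "HOL-Computational_Algebra.Computational_Algebra"
    "HOL-Library.Poly_Mapping"
begin

text \<open>
  The algebra is a type of class \<^class>\<open>comm_ring\<close> (so a unit is not required) together
  with a compatible scalar multiplication by a field.
\<close>

locale comm_algebra = vector_space scale
  for scale :: "'f::field \<Rightarrow> 'a::comm_ring \<Rightarrow> 'a" +
  assumes scale_mult_left: "scale c x * y = scale c (x * y)"

type_synonym 'a cochain = "'a \<Rightarrow> 'a \<Rightarrow> 'a"

definition cochain2 :: "('f::field \<Rightarrow> 'a::comm_ring \<Rightarrow> 'a) \<Rightarrow> 'a cochain \<Rightarrow> bool" where
  "cochain2 scale \<phi> \<longleftrightarrow>
     (\<forall>p. Vector_Spaces.linear scale scale (\<lambda>q. \<phi> p q)) \<and>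
     (\<forall>q. Vector_Spaces.linear scale scale (\<lambda>p. \<phi> p q))"

definition symmetric_cochain :: "'a cochain \<Rightarrow> bool" where
  "symmetric_cochain \<phi> \<longleftrightarrow> (\<forall>p q. \<phi> q p = \<phi> p q)"

definition antisymmetric_cochain :: "('a::comm_ring) cochain \<Rightarrow> bool" where
  "antisymmetric_cochain \<phi> \<longleftrightarrow> (\<forall>p q. \<phi> q p = - \<phi> p q)"

definition sym_part :: "('f::field \<Rightarrow> 'a::comm_ring \<Rightarrow> 'a) \<Rightarrow> 'a cochain \<Rightarrow> 'a cochain" where
  "sym_part scale \<phi> = (\<lambda>p q. scale (1/2) (\<phi> p q + \<phi> q p))"

definition antisym_part :: "('f::field \<Rightarrow> 'a::comm_ring \<Rightarrow> 'a) \<Rightarrow> 'a cochain \<Rightarrow> 'a cochain" where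
  "antisym_part scale \<phi> = (\<lambda>p q. scale (1/2) (\<phi> p q - \<phi> q p))"

definition jacobi :: "('a::comm_ring) cochain \<Rightarrow> bool" where
  "jacobi \<phi> \<longleftrightarrow> (\<forall>p q r. \<phi> (\<phi> p q) r + \<phi> (\<phi> q r) p + \<phi> (\<phi> r p) q = 0)"

definition biderivation :: "('f::field \<Rightarrow> 'a::comm_ring \<Rightarrow> 'a) \<Rightarrow> 'a cochain \<Rightarrow> bool" where
  "biderivation scale \<phi> \<longleftrightarrow> cochain2 scale \<phi> \<and>
     (\<forall>p q r. \<phi> (p * q) r = p * \<phi> q r + \<phi> p r * q) \<and>
     (\<forall>p q r. \<phi> r (p * q) = p * \<phi> r q + \<phi> r p * q)"

definition poisson_bracket :: "('f::field \<Rightarrow> 'a::comm_ring \<Rightarrow> 'a) \<Rightarrow> 'a cochain \<Rightarrow> bool" where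
  "poisson_bracket scale \<phi> \<longleftrightarrow>
     antisymmetric_cochain \<phi> \<and> biderivation scale \<phi> \<and> jacobi \<phi>"

text \<open>
  The list \<open>[\<pi>\<^sub>1, \<dots>, \<pi>\<^sub>n]\<close> stands for \<open>\<pi> + h \<pi>\<^sub>1 + \<cdots> + h\<^sup>n \<pi>\<^sub>n\<close>, where \<open>\<pi>\<close> is the product of
  the algebra; the order of the deformation is the length of the list.  The elements of \<open>A[[h]]\<close>
  are formal power series with coefficients in \<open>A\<close>, and the bilinear maps \<open>\<pi>\<^sub>k\<close> are extended to
  them by \<open>\<pi>\<^sub>k (\<Sum>\<^sub>i h\<^sup>i f\<^sub>i, \<Sum>\<^sub>j h\<^sup>j g\<^sub>j) = \<Sum>\<^sub>i\<^sub>j h\<^sup>i\<^sup>+\<^sup>j \<pi>\<^sub>k (f\<^sub>i, g\<^sub>j)\<close>.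
\<close>

definition deformed_product :: "('a::comm_ring) cochain list \<Rightarrow> 'a fps \<Rightarrow> 'a fps \<Rightarrow> 'a fps" where
  "deformed_product \<phi>s f g = Abs_fps (\<lambda>m.
     \<Sum>(k, i, j) \<in> {(k, i, j). k \<le> length \<phi>s \<and> k + i + j = m}.
       (((*) # \<phi>s) ! k) (fps_nth f i) (fps_nth g j))"

text \<open>Congruence modulo \<open>h\<^sup>n\<^sup>+\<^sup>1\<close> is equality of the coefficients of \<open>h\<^sup>0, \<dots>, h\<^sup>n\<close>.\<close>

definition deformation ::
    "('f::field \<Rightarrow> 'a::comm_ring \<Rightarrow> 'a) \<Rightarrow> 'a cochain list \<Rightarrow> bool" where
  "deformation scale \<phi>s \<longleftrightarrow>
     (\<forall>\<phi>\<in>set \<phi>s. cochain2 scale \<phi>) \<and>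
     (\<forall>f g k. \<forall>m\<le>length \<phi>s.
        fps_nth (deformed_product \<phi>s (deformed_product \<phi>s f g) k) m =
        fps_nth (deformed_product \<phi>s f (deformed_product \<phi>s g k)) m)"

definition extends_to_order ::
    "('f::field \<Rightarrow> 'a::comm_ring \<Rightarrow> 'a) \<Rightarrow> 'a cochain list \<Rightarrow> nat \<Rightarrow> bool" where
  "extends_to_order scale \<phi>s m \<longleftrightarrow> length \<phi>s < m \<and>
     (\<exists>\<psi>s. length (\<phi>s @ \<psi>s) = m \<and> deformation scale (\<phi>s @ \<psi>s))"

definition deformation_quantization ::
    "('f::field \<Rightarrow> 'a::comm_ring \<Rightarrow> 'a) \<Rightarrow> 'a cochain list \<Rightarrow> bool" where
  "deformation_quantization scale \<phi>s \<longleftrightarrow> deformation scale \<phi>s \<and>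
     (\<forall>k\<in>{1..length \<phi>s}.
        (even k \<longrightarrow> symmetric_cochain (((*) # \<phi>s) ! k)) \<and>
        (odd k \<longrightarrow> antisymmetric_cochain (((*) # \<phi>s) ! k)))"

text \<open>
  \<open>polys_in I\<close> is the polynomial ring in the variables \<open>x\<^sub>i\<close>, \<open>i \<in> I\<close>, inside the
  ring of all polynomials with variables indexed by \<^typ>\<open>'i\<close>: a monomial is a finitely supported
  exponent function, a polynomial a finitely supported coefficient function on monomials.  The set
  \<open>I\<close> is kept as a parameter so that it may also be empty.
\<close>

definition polys_in :: "'i set \<Rightarrow> (('i \<Rightarrow>\<^sub>0 nat) \<Rightarrow>\<^sub>0 'f::field) set" where
  "polys_in I = {P. \<forall>m\<in>Poly_Mapping.keys P. Poly_Mapping.keys m \<subseteq> I}"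

text \<open>The algebra is isomorphic, as an algebra over the field, to the one on \<open>polys_in I\<close>.\<close>

definition polynomial_algebra ::
    "('f::field \<Rightarrow> 'a::comm_ring \<Rightarrow> 'a) \<Rightarrow> 'i set \<Rightarrow> bool" where
  "polynomial_algebra scale I \<longleftrightarrow> comm_algebra scale \<and>
     (\<exists>\<Phi> :: (('i \<Rightarrow>\<^sub>0 nat) \<Rightarrow>\<^sub>0 'f) \<Rightarrow> 'a.
        bij_betw \<Phi> (polys_in I) UNIV \<and>
        (\<forall>P\<in>polys_in I. \<forall>Q\<in>polys_in I. \<Phi> (P + Q) = \<Phi> P + \<Phi> Q) \<and>
        (\<forall>P\<in>polys_in I. \<forall>Q\<in>polys_in I. \<Phi> (P * Q) = \<Phi> P * \<Phi> Q) \<and>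
        (\<forall>c. \<forall>P\<in>polys_in I. \<Phi> (Poly_Mapping.map ((*) c) P) = scale c (\<Phi> P)))"

text \<open>\<open>sym_part\<close> and \<open>antisym_part\<close> give the decomposition of a cochain, which is unique.\<close>

lemma cochain_decomposition:
  fixes scale :: "'f::field \<Rightarrow> 'a::comm_ring \<Rightarrow> 'a"
  assumes "CHAR('f) \<noteq> 2" and "vector_space scale"
  shows "symmetric_cochain \<sigma> \<and> antisymmetric_cochain \<alpha> \<and> \<phi> = (\<lambda>p q. \<sigma> p q + \<alpha> p q) \<longleftrightarrow>
         \<sigma> = sym_part scale \<phi> \<and> \<alpha> = antisym_part scale \<phi>"
proof -
  interpret vector_space scale by fact
  have two: "(2::'f) \<noteq> 0"
  proof
    assume "(2::'f) = 0"
    then have "of_nat 2 = (0::'f)" by simp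
    then have "CHAR('f) dvd 2" by (simp only: of_nat_eq_0_iff_char_dvd)
    then have "CHAR('f) = 1 \<or> CHAR('f) = 2"
      by (metis prime_nat_iff two_is_prime_nat)
    with assms(1) show False by simp
  qed
  have half: "scale (1/2) (x + x) = x" for x
  proof -
    have "scale (1/2) (x + x) = scale (1/2 + 1/2) x"
      by (simp only: scale_right_distrib scale_left_distrib)
    also have "1/2 + 1/2 = (1::'f)"
      using two by (simp add: field_simps)
    finally show ?thesis by simp
  qed
  show ?thesis
  proof
    assume L: "symmetric_cochain \<sigma> \<and> antisymmetric_cochain \<alpha> \<and> \<phi> = (\<lambda>p q. \<sigma> p q + \<alpha> p q)"
    have "sym_part scale \<phi> p q = \<sigma> p q" and "antisym_part scale \<phi> p q = \<alpha> p q" for p q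
    proof -
      have "\<phi> p q + \<phi> q p = \<sigma> p q + \<sigma> p q" "\<phi> p q - \<phi> q p = \<alpha> p q + \<alpha> p q"
      proof -
        have "\<phi> p q = \<sigma> p q + \<alpha> p q" "\<phi> q p = \<sigma> q p + \<alpha> q p" "\<sigma> q p = \<sigma> p q"
          using L by (auto simp: symmetric_cochain_def)
        moreover have "\<alpha> q p = - \<alpha> p q"
          using L unfolding antisymmetric_cochain_def by blast
        ultimately show "\<phi> p q + \<phi> q p = \<sigma> p q + \<sigma> p q" "\<phi> p q - \<phi> q p = \<alpha> p q + \<alpha> p q"
          by simp_all
      qed
      then show "sym_part scale \<phi> p q = \<sigma> p q" "antisym_part scale \<phi> p q = \<alpha> p q"
        by (simp_all only: sym_part_def antisym_part_def half)
    qed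
    then show "\<sigma> = sym_part scale \<phi> \<and> \<alpha> = antisym_part scale \<phi>" by (simp add: fun_eq_iff)
  next
    assume R: "\<sigma> = sym_part scale \<phi> \<and> \<alpha> = antisym_part scale \<phi>"
    have "sym_part scale \<phi> p q + antisym_part scale \<phi> p q = \<phi> p q" for p q
    proof -
      have "\<phi> p q + \<phi> q p + (\<phi> p q - \<phi> q p) = \<phi> p q + \<phi> p q" by simp
      then show ?thesis
        by (simp only: sym_part_def antisym_part_def half flip: scale_right_distrib)
    qed
    moreover have "antisymmetric_cochain (antisym_part scale \<phi>)"
      by (simp only: antisymmetric_cochain_def antisym_part_def minus_diff_eq
          flip: scale_minus_right) simp
    moreover have "symmetric_cochain (sym_part scale \<phi>)"
      by (simp add: symmetric_cochain_def sym_part_def add.commute)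
    ultimately show "symmetric_cochain \<sigma> \<and> antisymmetric_cochain \<alpha> \<and> \<phi> = (\<lambda>p q. \<sigma> p q + \<alpha> p q)"
      using R by simp
  qed
qed

end

theory Submission
  imports Defs
begin

text \<open>
  Extending a deformation by one order means solving \<open>\<delta>\<pi>\<^sub>n = f\<close>, where the obstruction \<open>f\<close> is a
  Hochschild 3-cocycle built from the lower terms.  At order 2 the alternating sum of \<open>f\<close> is the
  Jacobi expression of \<open>\<pi>\<^sub>1(p,q) - \<pi>\<^sub>1(q,p)\<close>, which gives the Jacobi identity since coboundaries have
  alternating sum zero.  At order 3, with \<open>\<pi>\<^sub>1\<close> antisymmetric and \<open>\<pi>\<^sub>2\<close> symmetric, \<open>f(p,q,r) = f(r,q,p)\<close>,
  so the alternating sum of \<open>f\<close> vanishes as well.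

  It remains to see that on a polynomial algebra a 3-cocycle with zero alternating sum is a
  coboundary, in any characteristic and for any set of variables.  A multilinear map is an arbitrary
  function on monomials, so this is a statement about the free commutative monoid.  Order the
  variables linearly.  After normalising \<open>f\<close>, one first finds a coboundary that makes
  \<open>f(x\<^sub>i,x\<^sub>j,b)\<close> symmetric in \<open>i\<close> and \<open>j\<close>, and then a second one that makes \<open>f(x\<^sub>k,b,c)\<close> vanish
  whenever \<open>x\<^sub>k\<close> is at least every variable of \<open>b\<close>.  The cocycle identity then forces \<open>f = 0\<close>.
  Both coboundaries are defined by recursion on the greatest variable of a monomial.
\<close>

section \<open>Hochschild operators of a commutative monoid acting on a ring\<close>

text \<open>
  The index type \<open>'m\<close> with operation \<open>op\<close> acts on the ring on both sides through \<open>X\<close>.  It is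
  instantiated by the free commutative monoid of monomials and by the algebra itself, with \<open>X\<close> the
  identity; in the latter case these are the Hochschild operators.
\<close>

definition coboundary2 ::
    "('m \<Rightarrow> 'a) \<Rightarrow> ('m \<Rightarrow> 'm \<Rightarrow> 'm) \<Rightarrow> ('m \<Rightarrow> 'm \<Rightarrow> 'a) \<Rightarrow> 'm \<Rightarrow> 'm \<Rightarrow> 'm \<Rightarrow> 'a::comm_ring" where
  "coboundary2 X op G a b c = X a * G b c - G (op a b) c + G a (op b c) - G a b * X c"

definition cocycle3 ::
    "('m \<Rightarrow> 'a) \<Rightarrow> ('m \<Rightarrow> 'm \<Rightarrow> 'm) \<Rightarrow> ('m \<Rightarrow> 'm \<Rightarrow> 'm \<Rightarrow> 'a::comm_ring) \<Rightarrow> bool" where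
  "cocycle3 X op F \<longleftrightarrow> (\<forall>a b c d.
     X a * F b c d - F (op a b) c d + F a (op b c) d - F a b (op c d) + F a b c * X d = 0)"

definition alternation :: "('m \<Rightarrow> 'm \<Rightarrow> 'm \<Rightarrow> 'a::comm_ring) \<Rightarrow> 'm \<Rightarrow> 'm \<Rightarrow> 'm \<Rightarrow> 'a" where
  "alternation F a b c = F a b c - F b a c + F b c a - F c b a + F c a b - F a c b"

lemma cocycle3D:
  "cocycle3 X op F \<Longrightarrow>
     X a * F b c d - F (op a b) c d + F a (op b c) d - F a b (op c d) + F a b c * X d = 0"
  by (simp add: cocycle3_def)

lemma alternation_diff:
  "alternation (\<lambda>a b c. F a b c - H a b c) a b c = alternation F a b c - alternation H a b c"
  by (simp add: alternation_def)

text \<open>Reversal is an odd permutation, so the six signed terms cancel in pairs, without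
  division by two.\<close>

lemma alternation_reversal_invariant:
  assumes "\<And>a b c. F c b a = F a b c"
  shows "alternation F a b c = 0"
  using assms[of c b a] assms[of b c a] assms[of c a b]
  by (simp add: alternation_def)

locale commutative_action =
  fixes X :: "'m \<Rightarrow> 'a::comm_ring" and op :: "'m \<Rightarrow> 'm \<Rightarrow> 'm"
  assumes op_assoc: "op (op a b) c = op a (op b c)"
    and op_commute: "op a b = op b a"
    and X_op: "X (op a b) = X a * X b"
begin

text \<open>By commutativity of \<open>op\<close>, each of the two inner terms is invariant under a
  transposition. The two outer terms differ by a cyclic, hence even, permutation and cancel each
  other.\<close>

lemma alternation_coboundary2: "alternation (coboundary2 X op G) a b c = 0"
  by (simp add: alternation_def coboundary2_def op_commute[of b a] op_commute[of c a]
      op_commute[of c b] algebra_simps)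

lemma cocycle3_coboundary2: "cocycle3 X op (coboundary2 X op G)"
  by (simp add: cocycle3_def coboundary2_def op_assoc X_op algebra_simps)

lemma cocycle3_diff_coboundary2:
  assumes "cocycle3 X op F"
  shows "cocycle3 X op (\<lambda>a b c. F a b c - coboundary2 X op G a b c)"
  unfolding cocycle3_def
proof (intro allI)
  fix a b c d
  let ?D = "coboundary2 X op G"
  show "X a * (F b c d - ?D b c d) - (F (op a b) c d - ?D (op a b) c d) +
       (F a (op b c) d - ?D a (op b c) d) - (F a b (op c d) - ?D a b (op c d)) +
       (F a b c - ?D a b c) * X d = 0"
    using cocycle3D[OF assms, of a b c d] cocycle3D[OF cocycle3_coboundary2, of a G b c d]
    by (simp add: algebra_simps)
qed

end

section \<open>Cohomology of a free commutative monoid\<close>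

locale ordered_monomials =
  fixes X :: "'i multiset \<Rightarrow> 'a::comm_ring" and r :: "('i \<times> 'i) set"
  assumes X_add: "X (a + b) = X a * X b"
    and X_empty: "X {#} * y = y"
    and lin: "linear_order_on UNIV r"
begin

sublocale commutative_action X "(+)"
  by unfold_locales (auto simp: ac_simps X_add)

section \<open>Monomials ordered by their greatest variable\<close>

abbreviation x :: "'i \<Rightarrow> 'a" where "x i \<equiv> X {#i#}"

definition leads :: "'i \<Rightarrow> 'i multiset \<Rightarrow> bool" where
  "leads k b \<longleftrightarrow> (\<forall>j\<in>#b. (j, k) \<in> r)"

lemma r_refl [simp]: "(i, i) \<in> r"
  using lin by (auto simp: order_on_defs refl_on_def)

lemma r_antisym: "(i, j) \<in> r \<Longrightarrow> (j, i) \<in> r \<Longrightarrow> i = j"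
  using lin by (auto simp: order_on_defs antisym_def)

lemma r_trans: "(i, j) \<in> r \<Longrightarrow> (j, k) \<in> r \<Longrightarrow> (i, k) \<in> r"
  using lin by (auto simp: order_on_defs dest: transD)

lemma r_total: "(i, j) \<in> r \<or> (j, i) \<in> r"
  using lin by (cases "i = j") (auto simp: order_on_defs total_on_def)

lemma leads_empty [simp]: "leads k {#}"
  by (simp add: leads_def)

lemma leads_add [simp]: "leads k (add_mset j b) \<longleftrightarrow> (j, k) \<in> r \<and> leads k b"
  by (auto simp: leads_def)

lemma leads_trans: "leads j b \<Longrightarrow> (j, k) \<in> r \<Longrightarrow> leads k b"
  by (auto simp: leads_def intro: r_trans)

lemma leader_exists: "b \<noteq> {#} \<Longrightarrow> \<exists>k\<in>#b. leads k b"
proof (induction b)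
  case (add j b)
  show ?case
  proof (cases "b = {#}")
    case False
    then obtain k where "k \<in># b" "leads k b" using add by auto
    then show ?thesis using r_total[of j k] by (auto intro: leads_trans)
  qed auto
qed auto

text \<open>Removing a greatest variable lowers the size, so every monomial arises by adding
  variables in weakly increasing order.\<close>

lemma monomial_induct [case_names empty add]:
  assumes "P {#}" and "\<And>k b. leads k b \<Longrightarrow> P b \<Longrightarrow> P (add_mset k b)"
  shows "P b"
proof (induction "size b" arbitrary: b)
  case (Suc n)
  then have "b \<noteq> {#}" by auto
  then obtain k where k: "k \<in># b" "leads k b" using leader_exists by blast
  then obtain b' where b: "b = add_mset k b'" by (metis multi_member_split)
  have "P b'" using Suc.hyps(2) by (intro Suc.hyps(1)) (simp add: b)
  moreover have "leads k b'" using k(2) by (simp add: b)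
  ultimately show ?case unfolding b by (intro assms(2))
qed (use assms(1) in auto)

lemma leader_unique:
  assumes "leads k b" "leads l b'" "add_mset k b = add_mset l b'"
  shows "k = l \<and> b = b'"
proof -
  have "leads k (add_mset k b)" "leads l (add_mset l b')" using assms(1,2) by auto
  then have "leads k (add_mset l b')" "leads l (add_mset k b)" by (simp_all only: assms(3))
  then have "(l, k) \<in> r" "(k, l) \<in> r" by simp_all
  then have "k = l" by (rule r_antisym[rotated])
  with assms(3) show ?thesis by simp
qed

text \<open>The graph of the function to be constructed. It is a relation because
  \<open>add_mset\<close> is not a free constructor; single-valuedness rests on
  \<open>leader_unique\<close>.\<close>

inductive fold_rel :: "('i \<Rightarrow> 'i multiset \<Rightarrow> 'a) \<Rightarrow> 'i multiset \<Rightarrow> 'a \<Rightarrow> bool"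
  for u where
  "fold_rel u {#} 0"
| "fold_rel u b v \<Longrightarrow> leads k b \<Longrightarrow> fold_rel u (add_mset k b) (u k b + x k * v)"

lemma fold_rel_unique: "fold_rel u b v \<Longrightarrow> fold_rel u b w \<Longrightarrow> v = w"
proof (induction arbitrary: w rule: fold_rel.induct)
  case 1
  then show ?case by cases auto
next
  case (2 b v k)
  from 2(4) show ?case
  proof cases
    case (2 b' v' k')
    then show ?thesis using leader_unique[of k b k' b'] "2.hyps" "2.IH" \<open>leads k b\<close> by metis
  qed auto
qed

text \<open>
  Every nonempty monomial splits off its greatest variable \<open>k\<close> uniquely, so \<open>h\<close> may be prescribed
  recursively along this splitting.
\<close>

lemma leading_recursion:
  "\<exists>h. h {#} = 0 \<and> (\<forall>k b. leads k b \<longrightarrow> h (add_mset k b) = u k b + x k * h b)"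
proof -
  have ex: "\<exists>v. fold_rel u b v" for b
    by (induction b rule: monomial_induct) (auto intro: fold_rel.intros)
  define h where "h b = (SOME v. fold_rel u b v)" for b
  have h: "fold_rel u b (h b)" for b
    unfolding h_def using ex by (rule someI_ex)
  show ?thesis
    by (rule exI[of _ h]) (blast intro: fold_rel.intros h fold_rel_unique)
qed

section \<open>Reducing a 3-cocycle on monomials to zero\<close>

definition normalised :: "('i multiset \<Rightarrow> 'i multiset \<Rightarrow> 'i multiset \<Rightarrow> 'a) \<Rightarrow> bool" where
  "normalised F \<longleftrightarrow> (\<forall>a b. F {#} a b = 0 \<and> F a {#} b = 0 \<and> F a b {#} = 0)"

abbreviation \<delta> where "\<delta> \<equiv> coboundary2 X (+)"

abbreviation cocycle where "cocycle \<equiv> cocycle3 X (+)"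

lemma X_empty_right: "y * X {#} = y"
  using X_empty by (simp add: mult.commute)

lemma normalise:
  assumes F: "cocycle F"
  shows "\<exists>G. normalised (\<lambda>a b c. F a b c - \<delta> G a b c)"
proof -
  have F1: "F {#} {#} {#} = 0"
    using cocycle3D[OF F, of "{#}" "{#}" "{#}" "{#}"] by (simp add: X_empty X_empty_right)
  \<comment> \<open>Chosen so that \<open>\<delta> G\<close> agrees with \<open>F\<close> at
    arguments \<open>{#}\<close>, \<open>{#}\<close>, \<open>c\<close> and \<open>a\<close>,
    \<open>{#}\<close>, \<open>{#}\<close>. The cocycle identity with two adjacent empty arguments
    then spreads the vanishing to every position.\<close>
  define G where "G a b = X a * F {#} {#} b - F a {#} {#} * X b" for a b
  define H where "H a b c = F a b c - \<delta> G a b c" for a b c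
  have H: "cocycle H"
    unfolding H_def using F by (rule cocycle3_diff_coboundary2)
  have H1: "H {#} {#} c = 0" and H2: "H a {#} {#} = 0" for a c
    by (simp_all add: H_def coboundary2_def G_def F1 X_empty X_empty_right)
  have "H {#} a b = 0" for a b
    using cocycle3D[OF H, of "{#}" "{#}" a b] by (simp add: X_empty X_empty_right H1)
  moreover have "H a {#} b = 0" for a b
    using cocycle3D[OF H, of a "{#}" "{#}" b] by (simp add: X_empty X_empty_right H1 H2)
  moreover have "H a b {#} = 0" for a b
    using cocycle3D[OF H, of a b "{#}" "{#}"] by (simp add: X_empty X_empty_right H2)
  ultimately show ?thesis
    unfolding normalised_def H_def by blast
qed

text \<open>A Poincare lemma for the commuting difference operators sending h to D_i h, where D_i
  h(b) = x_i h(b) - h(x_i b). The antisymmetrised \<open>F\<close> on generators is a closed 2-form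
  \<open>c\<close>; a primitive 1-form \<open>M\<close>, with c_ij = D_i M_j - D_j M_i, supplies
  \<open>G\<close>.\<close>

lemma symmetrise_on_generators:
  assumes F: "cocycle F" and N: "normalised F"
    and alt: "\<And>i j k. alternation F {#i#} {#j#} {#k#} = 0"
  shows "\<exists>G. normalised (\<lambda>a b c. F a b c - \<delta> G a b c) \<and>
    (\<forall>i j b. F {#i#} {#j#} b - \<delta> G {#i#} {#j#} b = F {#j#} {#i#} b - \<delta> G {#j#} {#i#} b)"
proof -
  define c where "c i j b = F {#i#} {#j#} b - F {#j#} {#i#} b" for i j b
  have c_empty: "c i j {#} = 0" for i j
    using N by (simp add: c_def normalised_def)
  have c_cocycle: "x i * c j k b - x j * c i k b + x k * c i j b
      - c j k (add_mset i b) + c i k (add_mset j b) - c i j (add_mset k b) = 0" for i j k b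
  proof -
    let ?Z = "\<lambda>i j k. x i * F {#j#} {#k#} b - F ({#i#} + {#j#}) {#k#} b + F {#i#} ({#j#} + {#k#}) b
        - F {#i#} {#j#} ({#k#} + b) + F {#i#} {#j#} {#k#} * X b"
    have Z: "?Z i j k = 0" for i j k
      using F by (rule cocycle3D)
    \<comment> \<open>In this signed sum of six cocycle identities all terms containing a product of
      two generators cancel by commutativity, and the terms multiplied by \<open>X b\<close> form
      the alternation.\<close>
    have "(x i * c j k b - x j * c i k b + x k * c i j b
        - c j k (add_mset i b) + c i k (add_mset j b) - c i j (add_mset k b))
        + alternation F {#i#} {#j#} {#k#} * X b
        = ?Z i j k - ?Z j i k + ?Z j k i - ?Z k j i + ?Z k i j - ?Z i k j"
      by (simp add: c_def alternation_def algebra_simps add_mset_commute)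
    then show ?thesis unfolding Z alt by simp
  qed
  \<comment> \<open>The value 0 for \<open>(k, i) \<in> r\<close> makes \<open>M i\<close> vanish on
    monomials in variables up to \<open>i\<close>. For \<open>k\<close> above \<open>i\<close> and
    leading \<open>b\<close>, the prescribed value then solves c_ik = D_i M_k - D_k M_i at
    \<open>b\<close>, as both \<open>M k\<close> terms vanish.\<close>
  have "\<exists>h. h {#} = 0 \<and> (\<forall>k b. leads k b \<longrightarrow>
      h (add_mset k b) = (if (k, i) \<in> r then 0 else c i k b) + x k * h b)" for i
    by (rule leading_recursion)
  then obtain M where M0: "\<And>i. M i {#} = 0" and
    M: "\<And>i k b. leads k b \<Longrightarrow> M i (add_mset k b) = (if (k, i) \<in> r then 0 else c i k b) + x k * M i b"
    by metis
  have M1: "M i {#j#} = 0" for i j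
    using M[of j "{#}" i] by (simp add: M0 c_empty)
  have M_small: "leads i b \<Longrightarrow> M i b = 0" for i b
    by (induction b rule: monomial_induct) (auto simp: M0 M)
  \<comment> \<open>The defect still to be cancelled.  For \<open>i < j < k\<close> with \<open>k\<close> leading, the cocycle identity of \<open>c\<close>
    gives \<open>e i j (k b) = x k * e i j b\<close>; the vanishing alternation enters through \<open>c_cocycle\<close>.\<close>
  define e where
    "e i j b = c i j b - x i * M j b - M i (add_mset j b) + x j * M i b + M j (add_mset i b)" for i j b
  have e_small: "e i j b = 0" if "(j, i) \<notin> r" "leads j b" for i j b
  proof -
    have "(i, j) \<in> r" using that r_total by blast
    then show ?thesis using that by (simp add: e_def M_small M)
  qed
  have e_less: "(j, i) \<notin> r \<Longrightarrow> e i j b = 0" for i j b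
  proof (induction b rule: monomial_induct)
    case empty
    then show ?case by (intro e_small) auto
  next
    case (add k b)
    show ?case
    proof (cases "(k, j) \<in> r")
      case True
      then have "leads j (add_mset k b)" using add by (auto intro: leads_trans)
      then show ?thesis using add e_small by blast
    next
      case False
      then have kj: "(j, k) \<in> r" using r_total by blast
      have ij: "(i, j) \<in> r" using add r_total by blast
      then have ik: "(i, k) \<in> r" using kj by (rule r_trans)
      have nki: "(k, i) \<notin> r" using False ij r_trans by blast
      have "M i (add_mset j (add_mset k b)) = c i k (add_mset j b) + x k * M i (add_mset j b)"
        using M[of k "add_mset j b" i] add kj nki by (simp add: add_mset_commute)
      moreover have "M j (add_mset i (add_mset k b)) = c j k (add_mset i b) + x k * M j (add_mset i b)"
        using M[of k "add_mset i b" j] add ik False by (simp add: add_mset_commute)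
      moreover have "M i (add_mset k b) = c i k b + x k * M i b"
        using M[of k b i] add nki by simp
      moreover have "M j (add_mset k b) = c j k b + x k * M j b"
        using M[of k b j] add False by simp
      ultimately have "e i j (add_mset k b) = x k * e i j b
          - (x i * c j k b - x j * c i k b + x k * c i j b
             - c j k (add_mset i b) + c i k (add_mset j b) - c i j (add_mset k b))"
        unfolding e_def by (simp add: algebra_simps)
      then show ?thesis using add c_cocycle by simp
    qed
  qed
  \<comment> \<open>Antisymmetry of \<open>e\<close> in \<open>i\<close> and \<open>j\<close>, and
    its vanishing for \<open>i = j\<close>, leave only the ordered case.\<close>
  have e_zero: "e i j b = 0" for i j b
  proof -
    have "e i j b = - e j i b" by (simp add: e_def c_def)
    moreover have "i = j \<Longrightarrow> e i j b = 0" by (simp add: e_def c_def)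
    ultimately show ?thesis using e_less[of i j b] e_less[of j i b] r_antisym[of i j] by fastforce
  qed
  \<comment> \<open>With \<open>G\<close> supported on single variables in its first argument, the
    term at a product of two generators drops out. \<open>M1\<close> removes the last term of
    \<open>\<delta> G\<close>, so antisymmetrising leaves exactly D_i M_j - D_j M_i.\<close>
  define G where "G a b = (if size a = 1 then M (THE i. a = {#i#}) b else 0)" for a b
  have G: "G {#i#} b = M i b" "G {#} b = 0" "G a {#} = 0" for i b a
    by (simp_all add: G_def M0)
  show ?thesis
  proof (intro exI conjI allI)
    show "normalised (\<lambda>a b c. F a b c - \<delta> G a b c)"
      using N by (simp add: normalised_def coboundary2_def G X_empty X_empty_right)
    show "F {#i#} {#j#} b - \<delta> G {#i#} {#j#} b = F {#j#} {#i#} b - \<delta> G {#j#} {#i#} b" for i j b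
      using e_zero[of i j b]
      by (simp add: coboundary2_def G M1 e_def c_def algebra_simps add_mset_commute)
  qed
qed

text \<open>Once the values with a leading first variable are made zero, symmetry on generators lets
  any first variable be exchanged with the greatest one.\<close>

lemma coboundary_if_symmetric_on_generators:
  assumes F: "cocycle F" and N: "normalised F"
    and sym: "\<And>i j b. F {#i#} {#j#} b = F {#j#} {#i#} b"
  shows "\<exists>G. F = \<delta> G"
proof -
  \<comment> \<open>This is \<open>\<delta> G {#k#} b n = F {#k#} b n\<close> solved for
    \<open>G (add_mset k b) n\<close>, where \<open>G\<close> vanishes if its first argument is a
    single variable. The last argument \<open>n\<close> is a mere parameter.\<close>
  have "\<exists>h. h {#} = 0 \<and> (\<forall>k b. leads k b \<longrightarrow> h (add_mset k b) = - F {#k#} b n + x k * h b)" for n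
    by (rule leading_recursion)
  then obtain h where h: "\<And>n. h n {#} = 0"
      "\<And>n k b. leads k b \<Longrightarrow> h n (add_mset k b) = - F {#k#} b n + x k * h n b"
    by metis
  define G where "G a n = h n a" for a n
  have G0: "G {#} n = 0" for n by (simp add: G_def h)
  have G1: "G {#k#} n = 0" for k n
    using h(2)[of k "{#}" n] N by (simp add: G_def h normalised_def)
  define H where "H a b c = F a b c - \<delta> G a b c" for a b c
  have H: "cocycle H"
    unfolding H_def using F by (rule cocycle3_diff_coboundary2)
  have H0: "H {#} b n = 0" for b n
    using N by (simp add: H_def coboundary2_def G0 X_empty normalised_def)
  have H_leads: "H {#k#} b n = 0" if "leads k b" for k b n
    using h(2)[OF that, of n] by (simp add: H_def coboundary2_def G1) (simp add: G_def)
  have H_sym: "H {#i#} {#j#} n = H {#j#} {#i#} n" for i j n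
    using sym[of i j n] by (simp add: H_def coboundary2_def G1 add_mset_commute)
  have H_gen: "H {#i#} b n = 0" for i b n
  proof (induction b arbitrary: i rule: monomial_induct)
    case empty
    then show ?case by (simp add: H_leads)
  next
    case (add k b)
    show ?case
    proof (cases "(k, i) \<in> r")
      case True
      then have "leads i (add_mset k b)" using add by (auto intro: leads_trans)
      then show ?thesis by (rule H_leads)
    next
      case False
      then have "(i, k) \<in> r" using r_total by blast
      then have "H {#k#} (add_mset i b) n = 0" using add by (intro H_leads) simp
      \<comment> \<open>On subtracting the two identities the product terms cancel,
        \<open>H_sym\<close> cancels the generator terms, and the induction hypothesis, for
        \<open>i\<close> and for \<open>k\<close>, removes the terms at \<open>b\<close>. What
        remains equates the goal with the value just shown to be zero.\<close>
      then show ?thesis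
        using cocycle3D[OF H, of "{#i#}" "{#k#}" b n] cocycle3D[OF H, of "{#k#}" "{#i#}" b n]
        by (simp add: H_sym[of k i] add.IH add_mset_commute[of k i]) (simp add: algebra_simps)
    qed
  qed
  have "H a b n = 0" for a b n
  proof (induction a arbitrary: b n)
    case empty
    then show ?case by (rule H0)
  next
    case (add i a)
    \<comment> \<open>With all values on generators zero, the identity collapses to
      \<open>H (add_mset i a) b n = x i * H a b n\<close>.\<close>
    then show ?case
      using cocycle3D[OF H, of "{#i#}" a b n] by (simp add: H_gen)
  qed
  then have "F = \<delta> G"
    by (simp add: H_def fun_eq_iff)
  then show ?thesis by blast
qed

lemma coboundary2_add:
  "\<delta> G a b c + \<delta> G' a b c = \<delta> (\<lambda>a b. G a b + G' a b) a b c"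
  by (simp add: coboundary2_def algebra_simps)

theorem coboundary_if_alternation_zero:
  assumes F: "cocycle F" and alt: "\<And>i j k. alternation F {#i#} {#j#} {#k#} = 0"
  shows "\<exists>G. F = \<delta> G"
proof -
  obtain G0 where N0: "normalised (\<lambda>a b c. F a b c - \<delta> G0 a b c)"
    using normalise[OF F] ..
  define F0 where "F0 = (\<lambda>a b c. F a b c - \<delta> G0 a b c)"
  have F0: "cocycle F0" "normalised F0"
    unfolding F0_def using cocycle3_diff_coboundary2[OF F] N0 .
  have "alternation F0 {#i#} {#j#} {#k#} = 0" for i j k
    by (simp add: F0_def alternation_diff alternation_coboundary2 alt)
  from symmetrise_on_generators[OF F0 this] obtain G1
    where N1: "normalised (\<lambda>a b c. F0 a b c - \<delta> G1 a b c)"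
      and S1: "\<And>i j b. F0 {#i#} {#j#} b - \<delta> G1 {#i#} {#j#} b = F0 {#j#} {#i#} b - \<delta> G1 {#j#} {#i#} b"
    by blast
  from coboundary_if_symmetric_on_generators[OF cocycle3_diff_coboundary2[OF F0(1)] N1 S1]
  obtain G2 where "(\<lambda>a b c. F0 a b c - \<delta> G1 a b c) = \<delta> G2"
    by blast
  then have "F a b c = \<delta> G0 a b c + (\<delta> G1 a b c + \<delta> G2 a b c)" for a b c
    by (auto simp: F0_def fun_eq_iff algebra_simps)
  then have "F = \<delta> (\<lambda>a b. G0 a b + (G1 a b + G2 a b))"
    by (simp add: coboundary2_add fun_eq_iff)
  then show ?thesis by blast
qed

end

section \<open>Hochschild cohomology of a polynomial algebra\<close>

definition monomial :: "'i multiset \<Rightarrow> 'i \<Rightarrow>\<^sub>0 nat" where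
  "monomial b = Abs_poly_mapping (count b)"

lemma lookup_monomial [simp]: "Poly_Mapping.lookup (monomial b) = count b"
proof -
  have "finite {i. count b i \<noteq> 0}"
    by (rule finite_subset[OF _ finite_set_mset[of b]]) (auto simp: count_eq_zero_iff)
  then show ?thesis by (simp add: monomial_def Abs_poly_mapping_inverse)
qed

lemma keys_monomial [simp]: "Poly_Mapping.keys (monomial b) = set_mset b"
  by (auto simp: in_keys_iff)

lemma monomial_add: "monomial (a + b) = monomial a + monomial b"
  by (rule poly_mapping_eqI) (simp add: lookup_add)

lemma monomial_empty [simp]: "monomial {#} = 0"
  by (rule poly_mapping_eqI) simp

lemma inj_monomial: "inj monomial"
proof
  fix a b :: "'i multiset"
  assume "monomial a = monomial b"
  then have "count a = count b" by (metis lookup_monomial)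
  then show "a = b" by (simp add: multiset_eq_iff)
qed

lemma ex_monomial: "\<exists>b. m = monomial b"
proof -
  have "finite {x. Poly_Mapping.lookup m x > 0}"
    using finite_lookup[of m] by (simp add: neq0_conv)
  then have "Poly_Mapping.lookup m = count (Abs_multiset (Poly_Mapping.lookup m))"
    by (rule count_Abs_multiset[symmetric])
  then have "m = monomial (Abs_multiset (Poly_Mapping.lookup m))"
    by (intro poly_mapping_eqI) simp
  then show ?thesis ..
qed

lemma sum_singles: "(\<Sum>m\<in>Poly_Mapping.keys P. Poly_Mapping.single m (Poly_Mapping.lookup P m)) = P"
  by (rule poly_mapping_eqI)
    (simp add: lookup_sum lookup_single when_def in_keys_iff)

lemma polys_in_closed:
  "0 \<in> polys_in I" "P \<in> polys_in I \<Longrightarrow> Q \<in> polys_in I \<Longrightarrow> P + Q \<in> polys_in I"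
  using keys_add[of P Q] by (auto simp: polys_in_def)

lemma single_in_polys_in: "set_mset b \<subseteq> I \<Longrightarrow> Poly_Mapping.single (monomial b) c \<in> polys_in I"
  by (simp add: polys_in_def)

lemma map_single_one: "Poly_Mapping.map ((*) c) (Poly_Mapping.single m 1) = Poly_Mapping.single m (c::'f::field)"
  by (rule poly_mapping_eqI) (simp add: map.rep_eq lookup_single when_def)

section \<open>Linear and bilinear maps determined on a basis of monomials\<close>

lemma (in vector_space) linear_rule:
  "(\<And>p q. g (p + q) = g p + g q) \<Longrightarrow> (\<And>c p. g (scale c p) = scale c (g p)) \<Longrightarrow>
    Vector_Spaces.linear scale scale g"
  using vector_space_axioms by (simp add: Vector_Spaces.linear_iff)

lemma (in comm_algebra) scale_mult_right: "p * scale c q = scale c (p * q)"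
  using scale_mult_left[of c q p] by (simp add: mult.commute)

text \<open>\<open>X\<close> is multiplicative on all multisets, so \<open>ordered_monomials\<close>
  applies over the whole index type, while only the indices in \<open>S\<close> give a basis.
  \<open>X {#}\<close> supplies the unit that the class does not provide.\<close>

locale monomial_basis = comm_algebra scale
  for scale :: "'f::field \<Rightarrow> 'a::comm_ring \<Rightarrow> 'a" +
  fixes X :: "'i multiset \<Rightarrow> 'a" and S :: "'i multiset set"
  assumes X_add: "X (a + b) = X a * X b"
    and X_empty: "X {#} * y = y"
    and S_add: "a \<in> S \<Longrightarrow> b \<in> S \<Longrightarrow> a + b \<in> S"
    and inj: "inj_on X S"
    and indep: "independent (X ` S)"
    and span: "span (X ` S) = UNIV"

lemma polynomial_algebra_monomial_basis:
  fixes scale :: "'f::field \<Rightarrow> 'a::comm_ring \<Rightarrow> 'a" and I :: "'i set"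
  assumes "polynomial_algebra scale I"
  shows "\<exists>X. monomial_basis scale X {b. set_mset b \<subseteq> I}"
proof -
  interpret comm_algebra scale using assms by (simp add: polynomial_algebra_def)
  from assms obtain \<Phi> :: "(('i \<Rightarrow>\<^sub>0 nat) \<Rightarrow>\<^sub>0 'f) \<Rightarrow> 'a" where
    bij: "bij_betw \<Phi> (polys_in I) UNIV"
    and add: "\<And>P Q. P \<in> polys_in I \<Longrightarrow> Q \<in> polys_in I \<Longrightarrow> \<Phi> (P + Q) = \<Phi> P + \<Phi> Q"
    and mult: "\<And>P Q. P \<in> polys_in I \<Longrightarrow> Q \<in> polys_in I \<Longrightarrow> \<Phi> (P * Q) = \<Phi> P * \<Phi> Q"
    and sc: "\<And>c P. P \<in> polys_in I \<Longrightarrow> \<Phi> (Poly_Mapping.map ((*) c) P) = scale c (\<Phi> P)"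
    unfolding polynomial_algebra_def by blast
  let ?S = "{b. set_mset b \<subseteq> I}"
  have zero: "\<Phi> 0 = 0"
    using add[of 0 0] by (simp add: polys_in_closed)
  have sum: "\<Phi> (sum p T) = (\<Sum>b\<in>T. \<Phi> (p b)) \<and> sum p T \<in> polys_in I"
    if "finite T" "\<And>b. b \<in> T \<Longrightarrow> p b \<in> polys_in I" for p and T :: "'i multiset set"
    using that by (induction rule: finite_induct) (auto simp: zero polys_in_closed add)
  \<comment> \<open>Discarding the variables outside \<open>I\<close> makes \<open>X\<close> multiplicative on all multisets.\<close>
  define X where "X b = \<Phi> (Poly_Mapping.single (monomial (filter_mset (\<lambda>i. i \<in> I) b)) 1)" for b
  have X_eq: "X b = \<Phi> (Poly_Mapping.single (monomial b) 1)" if "b \<in> ?S" for b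
  proof -
    have "filter_mset (\<lambda>i. i \<in> I) b = b" using that by (auto simp: filter_mset_eq_conv)
    then show ?thesis by (simp add: X_def)
  qed
  have scale_X: "scale c (X b) = \<Phi> (Poly_Mapping.single (monomial b) c)" if "b \<in> ?S" for c b
    using that sc[of "Poly_Mapping.single (monomial b) 1" c]
    by (simp add: X_eq map_single_one single_in_polys_in)
  have sum_scale_X: "(\<Sum>b\<in>T. scale (c b) (X b)) = \<Phi> (\<Sum>b\<in>T. Poly_Mapping.single (monomial b) (c b))"
    if "finite T" "T \<subseteq> ?S" for c T
    using that sum[of T "\<lambda>b. Poly_Mapping.single (monomial b) (c b)"]
    by (simp add: scale_X single_in_polys_in subset_eq)
  have inj: "inj_on \<Phi> (polys_in I)" and surj: "\<Phi> ` polys_in I = UNIV"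
    using bij by (simp_all add: bij_betw_def)
  have injX: "inj_on X ?S"
  proof
    fix a b assume ab: "a \<in> ?S" "b \<in> ?S" and "X a = X b"
    then have "Poly_Mapping.single (monomial a) (1::'f) = Poly_Mapping.single (monomial b) 1"
      by (intro inj_onD[OF inj]) (simp_all add: X_eq single_in_polys_in)
    then have "monomial a = monomial b" 
      by (metis keys_single singleton_inject zero_neq_one)
    then show "a = b" by (rule injD[OF inj_monomial])
  qed
  have "X (a + b) = X a * X b" for a b
    unfolding X_def
    by (subst mult[symmetric]) (auto simp: mult_single monomial_add intro!: single_in_polys_in)
  moreover have "X {#} * y = y" for y
  proof -
    obtain Q where "y = \<Phi> Q" "Q \<in> polys_in I" using surj by blast
    then show ?thesis
      using single_in_polys_in[of "{#}" I "1::'f"] by (simp add: X_def flip: mult)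
  qed
  moreover have "independent (X ` ?S)"
  proof
    assume "dependent (X ` ?S)"
    then obtain t u v where t: "finite t" "t \<subseteq> X ` ?S"
      and 0: "(\<Sum>v\<in>t. scale (u v) v) = 0" and v: "v \<in> t" "u v \<noteq> 0"
      unfolding dependent_explicit by blast
    obtain T where T: "T \<subseteq> ?S" "finite T" "t = X ` T"
      using finite_subset_image[OF t] by blast
    from v T obtain b where b: "b \<in> T" "v = X b" by blast
    let ?P = "\<Sum>b\<in>T. Poly_Mapping.single (monomial b) (u (X b))"
    have "\<Phi> ?P = (\<Sum>b\<in>T. scale (u (X b)) (X b))"
      using T by (intro sum_scale_X[symmetric])
    also have "\<dots> = 0"
      using 0 T inj_on_subset[OF injX T(1)] by (simp add: sum.reindex)
    finally have "\<Phi> ?P = \<Phi> 0" by (simp add: zero)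
    moreover have "?P \<in> polys_in I"
      using T by (intro sum[THEN conjunct2]) (auto intro!: single_in_polys_in)
    ultimately have "?P = 0"
      by (rule inj_onD[OF inj]) (rule polys_in_closed)
    \<comment> \<open>Distinct multisets give distinct monomials, so one coefficient isolates one
      scalar of the dependence.\<close>
    then have "0 = Poly_Mapping.lookup ?P (monomial b)" by simp
    also have "\<dots> = u (X b)"
      using T b by (simp add: lookup_sum lookup_single when_def inj_eq[OF inj_monomial])
    finally show False using b v by simp
  qed
  moreover have "y \<in> span (X ` ?S)" for y
  proof -
    obtain Q where Q: "y = \<Phi> Q" "Q \<in> polys_in I" using surj by blast
    define T where "T = monomial -` Poly_Mapping.keys Q"
    have "Poly_Mapping.keys (monomial b) \<subseteq> I" if "b \<in> T" for b
      using that Q(2) unfolding T_def polys_in_def by blast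
    then have T: "finite T" "T \<subseteq> ?S"
      by (auto simp: T_def finite_vimageI inj_monomial)
    have keys: "monomial ` T = Poly_Mapping.keys Q"
      using ex_monomial by (auto simp: T_def)
    have "Q = (\<Sum>b\<in>T. Poly_Mapping.single (monomial b) (Poly_Mapping.lookup Q (monomial b)))"
      by (subst sum_singles[symmetric])
        (simp add: sum.reindex inj_on_subset[OF inj_monomial] flip: keys)
    then have "y = (\<Sum>b\<in>T. scale (Poly_Mapping.lookup Q (monomial b)) (X b))"
      using Q(1) sum_scale_X[OF T] by simp
    also have "\<dots> \<in> span (X ` ?S)"
      using T by (intro span_sum span_scale span_base) auto
    finally show ?thesis .
  qed
  ultimately have "monomial_basis scale X ?S"
    using injX by unfold_locales auto
  then show ?thesis by blast
qed

context monomial_basis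
begin

interpretation pair: vector_space_pair scale scale ..

lemma linear_extend: "\<exists>g. Vector_Spaces.linear scale scale g \<and> (\<forall>b\<in>S. g (X b) = h b)"
  using pair.linear_independent_extend[OF indep, of "\<lambda>v. h (inv_into S X v)"] inj by auto

lemma linear_eqI:
  assumes "Vector_Spaces.linear scale scale g" "Vector_Spaces.linear scale scale h"
    and "\<And>b. b \<in> S \<Longrightarrow> g (X b) = h (X b)"
  shows "g p = h p"
  using pair.linear_eq_on[OF assms(1,2), of p "X ` S"] assms(3) span by auto

text \<open>Extension in one argument at a time: \<open>h\<close> extends the second argument over
  each basis index, then \<open>g\<close>, with its arguments swapped, extends the first. Linearity
  of \<open>g\<close> in its parameter follows by comparison on the basis.\<close>

lemma cochain2_extend: "\<exists>g. cochain2 scale g \<and> (\<forall>a\<in>S. \<forall>b\<in>S. g (X a) (X b) = G a b)"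
proof -
  obtain h where h: "\<And>a. Vector_Spaces.linear scale scale (h a)" "\<And>a b. b \<in> S \<Longrightarrow> h a (X b) = G a b"
    using linear_extend[of "G _"] by metis
  obtain g where g: "\<And>q. Vector_Spaces.linear scale scale (g q)" "\<And>q a. a \<in> S \<Longrightarrow> g q (X a) = h a q"
    using linear_extend[of "\<lambda>a. h a _"] by metis
  have 1: "g (p + q) r = g p r + g q r" for p q r
    by (rule linear_eqI[of "g (p + q)" "\<lambda>r. g p r + g q r"])
      (auto intro!: g pair.linear_compose_add simp: g(2) pair.linear_add[OF h(1)])
  have 2: "g (scale c p) r = scale c (g p r)" for c p r
    by (rule linear_eqI[of "g (scale c p)" "\<lambda>r. scale c (g p r)"])
      (auto intro!: g pair.linear_compose_scale_right simp: g(2) pair.linear_scale[OF h(1)])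
  have "Vector_Spaces.linear scale scale (\<lambda>q. g q p)" for p
    by (rule linear_rule) (simp_all add: 1 2)
  then have "cochain2 scale (\<lambda>p q. g q p)"
    by (simp add: cochain2_def g(1))
  moreover have "\<forall>a\<in>S. \<forall>b\<in>S. g (X b) (X a) = G a b"
    by (simp add: g h)
  ultimately show ?thesis by blast
qed

end

section \<open>Hochschild cochains of the algebra\<close>

definition cochain3 :: "('f::field \<Rightarrow> 'a::comm_ring \<Rightarrow> 'a) \<Rightarrow> ('a \<Rightarrow> 'a \<Rightarrow> 'a \<Rightarrow> 'a) \<Rightarrow> bool" where
  "cochain3 scale f \<longleftrightarrow>
     (\<forall>q r. Vector_Spaces.linear scale scale (\<lambda>p. f p q r)) \<and>
     (\<forall>p r. Vector_Spaces.linear scale scale (\<lambda>q. f p q r)) \<and>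
     (\<forall>p q. Vector_Spaces.linear scale scale (\<lambda>r. f p q r))"

context comm_algebra
begin

interpretation pair: vector_space_pair scale scale ..

lemma cochain2D:
  assumes "cochain2 scale g"
  shows "g (p + p') q = g p q + g p' q" "g p (q + q') = g p q + g p q'"
    "g (p - p') q = g p q - g p' q" "g p (q - q') = g p q - g p q'"
    "g (- p) q = - g p q" "g p (- q) = - g p q"
    "g 0 q = 0" "g p 0 = 0"
    "g (scale c p) q = scale c (g p q)" "g p (scale c q) = scale c (g p q)"
    "g (sum F T) q = (\<Sum>t\<in>T. g (F t) q)" "g p (sum F T) = (\<Sum>t\<in>T. g p (F t))"
proof -
  have l: "Vector_Spaces.linear scale scale (g p)" for p
    using assms by (simp add: cochain2_def)
  have r: "Vector_Spaces.linear scale scale (\<lambda>p. g p q)" for q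
    using assms by (simp add: cochain2_def)
  show "g (p + p') q = g p q + g p' q" "g p (q + q') = g p q + g p q'"
    "g (p - p') q = g p q - g p' q" "g p (q - q') = g p q - g p q'"
    "g (- p) q = - g p q" "g p (- q) = - g p q"
    "g 0 q = 0" "g p 0 = 0"
    "g (scale c p) q = scale c (g p q)" "g p (scale c q) = scale c (g p q)"
    "g (sum F T) q = (\<Sum>t\<in>T. g (F t) q)" "g p (sum F T) = (\<Sum>t\<in>T. g p (F t))"
    by (fact pair.linear_add[OF l] pair.linear_add[OF r] pair.linear_diff[OF l] pair.linear_diff[OF r]
      pair.linear_neg[OF l] pair.linear_neg[OF r] pair.linear_0[OF l] pair.linear_0[OF r]
      pair.linear_scale[OF l] pair.linear_scale[OF r] pair.linear_sum[OF l] pair.linear_sum[OF r])+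
qed

lemma cochain2I:
  assumes "\<And>p p' q. g (p + p') q = g p q + g p' q" "\<And>p q q'. g p (q + q') = g p q + g p q'"
    "\<And>c p q. g (scale c p) q = scale c (g p q)" "\<And>c p q. g p (scale c q) = scale c (g p q)"
  shows "cochain2 scale g"
  unfolding cochain2_def by (intro conjI allI linear_rule) (simp_all add: assms)

lemma cochain2_mult: "cochain2 scale (*)"
  by (intro cochain2I)
    (simp_all add: algebra_simps scale_mult_left scale_mult_right)

lemma cochain3I:
  assumes "\<And>p p' q r. f (p + p') q r = f p q r + f p' q r" "\<And>p q q' r. f p (q + q') r = f p q r + f p q' r"
    "\<And>p q r r'. f p q (r + r') = f p q r + f p q r'"
    "\<And>c p q r. f (scale c p) q r = scale c (f p q r)" "\<And>c p q r. f p (scale c q) r = scale c (f p q r)"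
    "\<And>c p q r. f p q (scale c r) = scale c (f p q r)"
  shows "cochain3 scale f"
  unfolding cochain3_def by (intro conjI allI linear_rule) (simp_all add: assms)

end

abbreviation hochschild2 :: "'a::comm_ring cochain \<Rightarrow> 'a \<Rightarrow> 'a \<Rightarrow> 'a \<Rightarrow> 'a" where
  "hochschild2 \<equiv> coboundary2 (\<lambda>p. p) (*)"

interpretation hochschild: commutative_action "\<lambda>p. p" "(*) :: 'a::comm_ring \<Rightarrow> 'a \<Rightarrow> 'a"
  by unfold_locales (simp_all add: ac_simps)

lemma (in comm_algebra) cochain3_hochschild2:
  assumes "cochain2 scale g"
  shows "cochain3 scale (hochschild2 g)"
  by (rule cochain3I)
    (simp_all add: coboundary2_def cochain2D[OF assms] cochain2D[OF cochain2_mult] algebra_simps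
      scale_right_distrib scale_right_diff_distrib)

lemma (in monomial_basis) cochain3_eqI:
  assumes f: "cochain3 scale f" and h: "cochain3 scale h"
    and eq: "\<And>a b c. a \<in> S \<Longrightarrow> b \<in> S \<Longrightarrow> c \<in> S \<Longrightarrow> f (X a) (X b) (X c) = h (X a) (X b) (X c)"
  shows "f = h"
proof -
  have "f (X a) (X b) r = h (X a) (X b) r" if "a \<in> S" "b \<in> S" for a b r
    by (rule linear_eqI) (use f h eq that in \<open>auto simp: cochain3_def\<close>)
  then have "f (X a) q r = h (X a) q r" if "a \<in> S" for a q r
    by (rule_tac linear_eqI) (use f h that in \<open>auto simp: cochain3_def\<close>)
  then have "f p q r = h p q r" for p q r
    by (rule_tac linear_eqI) (use f h in \<open>auto simp: cochain3_def\<close>)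
  then show ?thesis by (simp add: fun_eq_iff)
qed

text \<open>Restricted to monomials, \<open>f\<close> becomes a cocycle on the free commutative
  monoid. Its primitive there is an arbitrary function on pairs of monomials, which extends
  bilinearly from the basis.\<close>

theorem (in monomial_basis) hochschild_coboundary:
  assumes f: "cochain3 scale f" and coc: "cocycle3 (\<lambda>p. p) (*) f"
    and alt: "\<And>p q r. alternation f p q r = 0"
  shows "\<exists>g. cochain2 scale g \<and> f = hochschild2 g"
proof -
  obtain r :: "'i rel" where "well_order_on UNIV r" using well_order_on by blast
  then interpret M: ordered_monomials X r
    using X_add X_empty by unfold_locales (auto simp: well_order_on_def)
  define F where "F a b c = f (X a) (X b) (X c)" for a b c
  have "cocycle3 X (+) F"
    using cocycle3D[OF coc] by (simp add: cocycle3_def F_def X_add)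
  moreover have "alternation F a b c = 0" for a b c
    using alt[of "X a" "X b" "X c"] by (simp add: alternation_def F_def)
  ultimately obtain G where G: "F = coboundary2 X (+) G"
    using M.coboundary_if_alternation_zero by blast
  obtain g where g: "cochain2 scale g" "\<And>a b. a \<in> S \<Longrightarrow> b \<in> S \<Longrightarrow> g (X a) (X b) = G a b"
    using cochain2_extend by metis
  have "f = hochschild2 g"
  proof (rule cochain3_eqI[OF f cochain3_hochschild2[OF g(1)]])
    fix a b c assume abc: "a \<in> S" "b \<in> S" "c \<in> S"
    have "f (X a) (X b) (X c) = F a b c" by (simp add: F_def)
    also have "\<dots> = hochschild2 g (X a) (X b) (X c)"
      using abc by (simp add: G coboundary2_def g(2) S_add flip: X_add)
    finally show "f (X a) (X b) (X c) = hochschild2 g (X a) (X b) (X c)" .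
  qed
  with g(1) show ?thesis by blast
qed

section \<open>Deformations and their obstructions\<close>

lemma all_le_Suc: "(\<forall>m\<le>Suc n. Q m) \<longleftrightarrow> (\<forall>m\<le>n. Q m) \<and> Q (Suc n)"
  by (auto simp: le_Suc_eq)

lemma finite_tuples:
  "finite {(i, j, k). i + j + k = (m::nat)}" "finite {(i, j, k, l). i + j + k + l = (m::nat)}"
proof -
  show "finite {(i, j, k). i + j + k = m}"
    by (rule finite_subset[of _ "{..m} \<times> {..m} \<times> {..m}"]) auto
  show "finite {(i, j, k, l). i + j + k + l = m}"
    by (rule finite_subset[of _ "{..m} \<times> {..m} \<times> {..m} \<times> {..m}"]) auto
qed

text \<open>Regroups an iterated product by the powers \<open>u\<close>, \<open>v\<close>,
  \<open>w\<close> of h coming from the three arguments and the total order \<open>s\<close> of the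
  two cochains, \<open>k\<close> being the outer and \<open>s - k\<close> the inner one.\<close>

lemma sum_tuples_left:
  fixes F :: "nat \<Rightarrow> nat \<Rightarrow> nat \<Rightarrow> nat \<Rightarrow> nat \<Rightarrow> 'a::comm_monoid_add"
  shows "(\<Sum>(k, i, j)\<in>{(k, i, j). k + i + j = m}. \<Sum>(k', u, v)\<in>{(k', u, v). k' + u + v = i}. F k k' u v j) =
    (\<Sum>(u, v, w, s)\<in>{(u, v, w, s). u + v + w + s = m}. \<Sum>k\<le>s. F k (s - k) u v w)"
proof -
  have "(\<Sum>(k, i, j)\<in>{(k, i, j). k + i + j = m}. \<Sum>(k', u, v)\<in>{(k', u, v). k' + u + v = i}. F k k' u v j) =
    (\<Sum>((k, i, j), (k', u, v)) \<in> Sigma {(k, i, j). k + i + j = m} (\<lambda>(k, i, j). {(k', u, v). k' + u + v = i}).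
      F k k' u v j)"
    by (subst sum.Sigma[symmetric]) (auto simp: finite_tuples finite_tuples[unfolded split_def] split_def intro!: sum.cong)
  also have "\<dots> = (\<Sum>((u, v, w, s), k) \<in> Sigma {(u, v, w, s). u + v + w + s = m} (\<lambda>(u, v, w, s). {..s}).
      F k (s - k) u v w)"
    by (rule sum.reindex_bij_witness[of _ "\<lambda>((u, v, w, s), k). ((k, s - k + u + v, w), (s - k, u, v))"
          "\<lambda>((k, i, j), (k', u, v)). ((u, v, j, k + k'), k)"]) auto
  also have "\<dots> = (\<Sum>(u, v, w, s)\<in>{(u, v, w, s). u + v + w + s = m}. \<Sum>k\<le>s. F k (s - k) u v w)"
    by (subst sum.Sigma[symmetric]) (auto simp: finite_tuples finite_tuples[unfolded split_def] split_def intro!: sum.cong)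
  finally show ?thesis .
qed

lemma sum_tuples_right:
  fixes F :: "nat \<Rightarrow> nat \<Rightarrow> nat \<Rightarrow> nat \<Rightarrow> nat \<Rightarrow> 'a::comm_monoid_add"
  shows "(\<Sum>(k, j, i)\<in>{(k, j, i). k + j + i = m}. \<Sum>(k', v, w)\<in>{(k', v, w). k' + v + w = i}. F k k' j v w) =
    (\<Sum>(u, v, w, s)\<in>{(u, v, w, s). u + v + w + s = m}. \<Sum>k\<le>s. F k (s - k) u v w)"
proof -
  have "(\<Sum>(k, j, i)\<in>{(k, j, i). k + j + i = m}. \<Sum>(k', v, w)\<in>{(k', v, w). k' + v + w = i}. F k k' j v w) =
    (\<Sum>((k, j, i), (k', v, w)) \<in> Sigma {(k, j, i). k + j + i = m} (\<lambda>(k, j, i). {(k', v, w). k' + v + w = i}).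
      F k k' j v w)"
    by (subst sum.Sigma[symmetric]) (auto simp: finite_tuples finite_tuples[unfolded split_def] split_def intro!: sum.cong)
  also have "\<dots> = (\<Sum>((u, v, w, s), k) \<in> Sigma {(u, v, w, s). u + v + w + s = m} (\<lambda>(u, v, w, s). {..s}).
      F k (s - k) u v w)"
    by (rule sum.reindex_bij_witness[of _ "\<lambda>((u, v, w, s), k). ((k, u, s - k + v + w), (s - k, v, w))"
          "\<lambda>((k, j, i), (k', v, w)). ((j, v, w, k + k'), k)"]) auto
  also have "\<dots> = (\<Sum>(u, v, w, s)\<in>{(u, v, w, s). u + v + w + s = m}. \<Sum>k\<le>s. F k (s - k) u v w)"
    by (subst sum.Sigma[symmetric]) (auto simp: finite_tuples finite_tuples[unfolded split_def] split_def intro!: sum.cong)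
  finally show ?thesis .
qed

lemma deformed_product_nth:
  assumes "m \<le> length \<phi>s"
  shows "fps_nth (deformed_product \<phi>s f g) m =
    (\<Sum>(k, i, j)\<in>{(k, i, j). k + i + j = m}. (((*) # \<phi>s) ! k) (fps_nth f i) (fps_nth g j))"
  using assms unfolding deformed_product_def fps_nth_Abs_fps by (intro sum.cong) auto

text \<open>By bilinearity over power series in h, associativity need only be tested on constant
  series, that is, on elements of the algebra.\<close>

theorem (in comm_algebra) deformation_iff:
  "deformation scale \<phi>s \<longleftrightarrow> (\<forall>\<phi>\<in>set \<phi>s. cochain2 scale \<phi>) \<and>
    (\<forall>m\<le>length \<phi>s. \<forall>p q r.
      (\<Sum>k\<le>m. (((*) # \<phi>s) ! k) ((((*) # \<phi>s) ! (m - k)) p q) r) =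
      (\<Sum>k\<le>m. (((*) # \<phi>s) ! k) p ((((*) # \<phi>s) ! (m - k)) q r)))"
proof (cases "\<forall>\<phi>\<in>set \<phi>s. cochain2 scale \<phi>")
  case True
  define P where "P k = ((*) # \<phi>s) ! k" for k
  have P: "cochain2 scale (P k)" if "k \<le> length \<phi>s" for k
    using True that by (cases k) (auto simp: P_def cochain2_mult)
  \<comment> \<open>The coefficients of h^s in the two bracketings of constants \<open>p\<close>,
    \<open>q\<close>, \<open>r\<close>.\<close>
  define L R where "L s p q r = (\<Sum>k\<le>s. P k (P (s - k) p q) r)"
    and "R s p q r = (\<Sum>k\<le>s. P k p (P (s - k) q r))" for s p q r
  let ?T = "\<lambda>m. {(u, v, w, s). u + v + w + s = (m::nat)}"
  let ?D = "deformed_product \<phi>s"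
  have DL: "fps_nth (?D (?D f g) h) m = (\<Sum>(u, v, w, s)\<in>?T m. L s (fps_nth f u) (fps_nth g v) (fps_nth h w))"
    if "m \<le> length \<phi>s" for f g h m
  proof -
    have "fps_nth (?D (?D f g) h) m = (\<Sum>(k, i, j)\<in>{(k, i, j). k + i + j = m}. \<Sum>(k', u, v)\<in>{(k', u, v). k' + u + v = i}.
        P k (P k' (fps_nth f u) (fps_nth g v)) (fps_nth h j))"
      unfolding deformed_product_nth[OF that] P_def[symmetric]
      using that by (intro sum.cong) (auto simp: deformed_product_nth cochain2D[OF P] P_def[symmetric] split_def)
    also have "\<dots> = (\<Sum>(u, v, w, s)\<in>?T m. L s (fps_nth f u) (fps_nth g v) (fps_nth h w))"
      unfolding L_def by (rule sum_tuples_left)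
    finally show ?thesis .
  qed
  have DR: "fps_nth (?D f (?D g h)) m = (\<Sum>(u, v, w, s)\<in>?T m. R s (fps_nth f u) (fps_nth g v) (fps_nth h w))"
    if "m \<le> length \<phi>s" for f g h m
  proof -
    have "fps_nth (?D f (?D g h)) m = (\<Sum>(k, j, i)\<in>{(k, j, i). k + j + i = m}. \<Sum>(k', v, w)\<in>{(k', v, w). k' + v + w = i}.
        P k (fps_nth f j) (P k' (fps_nth g v) (fps_nth h w)))"
      unfolding deformed_product_nth[OF that] P_def[symmetric]
      using that by (intro sum.cong) (auto simp: deformed_product_nth cochain2D[OF P] P_def[symmetric] split_def)
    also have "\<dots> = (\<Sum>(u, v, w, s)\<in>?T m. R s (fps_nth f u) (fps_nth g v) (fps_nth h w))"
      unfolding R_def by (rule sum_tuples_right)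
    finally show ?thesis .
  qed
  have zero: "L s 0 q r = 0" "L s p 0 r = 0" "L s p q 0 = 0" "R s 0 q r = 0" "R s p 0 r = 0" "R s p q 0 = 0"
    if "s \<le> length \<phi>s" for s p q r
    using that by (simp_all add: L_def R_def cochain2D[OF P])
  \<comment> \<open>Constant series contribute only at \<open>u = v = w = 0\<close>, which forces
    \<open>s = m\<close>.\<close>
  have const: "(\<Sum>(u, v, w, s)\<in>?T m. A s (fps_nth (fps_const p) u) (fps_nth (fps_const q) v) (fps_nth (fps_const r) w))
      = A m p q r"
    if "\<And>s q r. s \<le> m \<Longrightarrow> A s 0 q r = 0" "\<And>s p r. s \<le> m \<Longrightarrow> A s p 0 r = 0"
      "\<And>s p q. s \<le> m \<Longrightarrow> A s p q 0 = 0"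
    for A :: "nat \<Rightarrow> 'a \<Rightarrow> 'a \<Rightarrow> 'a \<Rightarrow> 'a" and m p q r
  proof -
    have "(\<Sum>(u, v, w, s)\<in>?T m. A s (fps_nth (fps_const p) u) (fps_nth (fps_const q) v) (fps_nth (fps_const r) w))
      = (\<Sum>(u, v, w, s)\<in>{(0, 0, 0, m)}. A s (fps_nth (fps_const p) u) (fps_nth (fps_const q) v) (fps_nth (fps_const r) w))"
      using that by (intro sum.mono_neutral_right finite_tuples) (auto split: if_splits)
    then show ?thesis by simp
  qed
  have "L m p q r = R m p q r"
    if "m \<le> length \<phi>s" "\<forall>f g h. \<forall>m\<le>length \<phi>s. fps_nth (?D (?D f g) h) m = fps_nth (?D f (?D g h)) m"
    for m p q r
  proof -
    have zeros: "s \<le> length \<phi>s" if "s \<le> m" for s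
      using that \<open>m \<le> length \<phi>s\<close> by simp
    have "fps_nth (?D (?D (fps_const p) (fps_const q)) (fps_const r)) m = L m p q r"
      unfolding DL[OF that(1)] by (rule const) (blast intro: zero zeros)+
    moreover have "fps_nth (?D (fps_const p) (?D (fps_const q) (fps_const r))) m = R m p q r"
      unfolding DR[OF that(1)] by (rule const) (blast intro: zero zeros)+
    ultimately show ?thesis using that by simp
  qed
  moreover have "fps_nth (?D (?D f g) h) m = fps_nth (?D f (?D g h)) m"
    if "m \<le> length \<phi>s" "\<forall>m\<le>length \<phi>s. \<forall>p q r. L m p q r = R m p q r" for f g h m
    using that by (auto simp: DL DR intro!: sum.cong)
  ultimately show ?thesis
    using True unfolding deformation_def L_def R_def P_def by blast
next
  case False
  then show ?thesis by (auto simp: deformation_def)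
qed

section \<open>Obstructions at orders two and three\<close>

definition associator :: "'a::comm_ring cochain \<Rightarrow> 'a cochain \<Rightarrow> 'a \<Rightarrow> 'a \<Rightarrow> 'a \<Rightarrow> 'a" where
  "associator \<phi> \<psi> p q r = \<phi> (\<psi> p q) r - \<phi> p (\<psi> q r)"

text \<open>\<open>associator \<phi> \<psi>\<close> is the Gerstenhaber composition with
  \<open>\<psi>\<close> inside, so this sum is the Gerstenhaber bracket of \<open>\<pi>1\<close> and
  \<open>\<pi>2\<close>.\<close>

definition obstruction3 :: "'a::comm_ring cochain \<Rightarrow> 'a cochain \<Rightarrow> 'a \<Rightarrow> 'a \<Rightarrow> 'a \<Rightarrow> 'a" where
  "obstruction3 \<pi>1 \<pi>2 p q r = associator \<pi>1 \<pi>2 p q r + associator \<pi>2 \<pi>1 p q r"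

context comm_algebra
begin

lemma deformation1_iff:
  "deformation scale [\<pi>1] \<longleftrightarrow> cochain2 scale \<pi>1 \<and> hochschild2 \<pi>1 = (\<lambda>p q r. 0)"
proof -
  have "p * q * r = p * (q * r)" for p q r :: 'a by (rule mult.assoc)
  moreover have "\<pi>1 p q * r + \<pi>1 (p * q) r = p * \<pi>1 q r + \<pi>1 p (q * r) \<longleftrightarrow> hochschild2 \<pi>1 p q r = 0" for p q r
    by (auto simp: coboundary2_def algebra_simps)
  ultimately show ?thesis
    unfolding deformation_iff by (simp add: all_le_Suc fun_eq_iff)
qed

text \<open>In the top coefficient, the terms pairing the new cochain with the product form its
  Hochschild coboundary; the rest are compositions of earlier cochains.\<close>

lemma deformation2_iff:
  "deformation scale [\<pi>1, \<pi>2] \<longleftrightarrow>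
    deformation scale [\<pi>1] \<and> cochain2 scale \<pi>2 \<and> hochschild2 \<pi>2 = associator \<pi>1 \<pi>1"
proof -
  have "\<pi>2 p q * r + \<pi>1 (\<pi>1 p q) r + \<pi>2 (p * q) r = p * \<pi>2 q r + \<pi>1 p (\<pi>1 q r) + \<pi>2 p (q * r)
      \<longleftrightarrow> hochschild2 \<pi>2 p q r = associator \<pi>1 \<pi>1 p q r" for p q r
    by (auto simp: coboundary2_def associator_def algebra_simps)
  then show ?thesis
    unfolding deformation_iff by (auto simp: all_le_Suc fun_eq_iff)
qed

lemma deformation3_iff:
  "deformation scale [\<pi>1, \<pi>2, \<pi>3] \<longleftrightarrow>
    deformation scale [\<pi>1, \<pi>2] \<and> cochain2 scale \<pi>3 \<and> hochschild2 \<pi>3 = obstruction3 \<pi>1 \<pi>2"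
proof -
  have "\<pi>3 p q * r + \<pi>1 (\<pi>2 p q) r + \<pi>2 (\<pi>1 p q) r + \<pi>3 (p * q) r
      = p * \<pi>3 q r + \<pi>1 p (\<pi>2 q r) + \<pi>2 p (\<pi>1 q r) + \<pi>3 p (q * r)
      \<longleftrightarrow> hochschild2 \<pi>3 p q r = obstruction3 \<pi>1 \<pi>2 p q r" for p q r
    by (auto simp: coboundary2_def obstruction3_def associator_def algebra_simps)
  then show ?thesis
    unfolding deformation_iff by (auto simp: all_le_Suc fun_eq_iff)
qed

lemma cochain3_associator:
  assumes "cochain2 scale \<phi>" "cochain2 scale \<psi>"
  shows "cochain3 scale (associator \<phi> \<psi>)"
  by (rule cochain3I) 
    (simp_all add: associator_def cochain2D[OF assms(1)] cochain2D[OF assms(2)] algebra_simps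
      scale_right_diff_distrib)

lemma cochain3_obstruction3:
  assumes "cochain2 scale \<phi>" "cochain2 scale \<psi>"
  shows "cochain3 scale (obstruction3 \<phi> \<psi>)"
  by (rule cochain3I) 
    (simp_all add: obstruction3_def associator_def cochain2D[OF assms(1)] cochain2D[OF assms(2)] algebra_simps
      scale_right_diff_distrib scale_right_distrib)

text \<open>The differential of the associator collects into terms that each contain the coboundary
  of \<open>\<pi>1\<close>, which is zero.\<close>

lemma cocycle3_associator:
  assumes c: "cochain2 scale \<pi>1" and z: "hochschild2 \<pi>1 = (\<lambda>p q r. 0)"
  shows "cocycle3 (\<lambda>p. p) (*) (associator \<pi>1 \<pi>1)"
  unfolding cocycle3_def
proof (intro allI)
  fix p q r s
  define Z where "Z = hochschild2 \<pi>1"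
  have "p * associator \<pi>1 \<pi>1 q r s - associator \<pi>1 \<pi>1 (p * q) r s + associator \<pi>1 \<pi>1 p (q * r) s
      - associator \<pi>1 \<pi>1 p q (r * s) + associator \<pi>1 \<pi>1 p q r * s
    = \<pi>1 (Z p q r) s + \<pi>1 p (Z q r s) - Z (\<pi>1 p q) r s + Z p (\<pi>1 q r) s - Z p q (\<pi>1 r s)"
    by (simp add: Z_def coboundary2_def associator_def cochain2D[OF c] algebra_simps)
  then show "p * associator \<pi>1 \<pi>1 q r s - associator \<pi>1 \<pi>1 (p * q) r s + associator \<pi>1 \<pi>1 p (q * r) s
      - associator \<pi>1 \<pi>1 p q (r * s) + associator \<pi>1 \<pi>1 p q r * s = 0"
    by (simp add: Z_def z cochain2D[OF c])
qed

text \<open>The differential collects into terms containing \<open>Z\<close> or \<open>W\<close>,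
  the defects of the first and second order equations. The terms cubic in \<open>\<pi>1\<close> that
  \<open>W\<close> introduces cancel identically.\<close>

lemma cocycle3_obstruction3:
  assumes c: "cochain2 scale \<pi>1" "cochain2 scale \<pi>2" and z: "hochschild2 \<pi>1 = (\<lambda>p q r. 0)"
    and z2: "hochschild2 \<pi>2 = associator \<pi>1 \<pi>1"
  shows "cocycle3 (\<lambda>p. p) (*) (obstruction3 \<pi>1 \<pi>2)"
  unfolding cocycle3_def
proof (intro allI)
  fix p q r s
  define Z where "Z = hochschild2 \<pi>1"
  define W where "W p q r = hochschild2 \<pi>2 p q r - associator \<pi>1 \<pi>1 p q r" for p q r
  have "p * obstruction3 \<pi>1 \<pi>2 q r s - obstruction3 \<pi>1 \<pi>2 (p * q) r s + obstruction3 \<pi>1 \<pi>2 p (q * r) s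
      - obstruction3 \<pi>1 \<pi>2 p q (r * s) + obstruction3 \<pi>1 \<pi>2 p q r * s
    = \<pi>2 (Z p q r) s + \<pi>2 p (Z q r s) - Z (\<pi>2 p q) r s + Z p (\<pi>2 q r) s - Z p q (\<pi>2 r s)
      + \<pi>1 (W p q r) s + \<pi>1 p (W q r s) - W (\<pi>1 p q) r s + W p (\<pi>1 q r) s - W p q (\<pi>1 r s)"
    by (simp add: Z_def W_def coboundary2_def obstruction3_def associator_def cochain2D[OF c(1)]
        cochain2D[OF c(2)] algebra_simps)
  then show "p * obstruction3 \<pi>1 \<pi>2 q r s - obstruction3 \<pi>1 \<pi>2 (p * q) r s + obstruction3 \<pi>1 \<pi>2 p (q * r) s
      - obstruction3 \<pi>1 \<pi>2 p q (r * s) + obstruction3 \<pi>1 \<pi>2 p q r * s = 0"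
    by (simp add: Z_def W_def z z2 cochain2D[OF c(1)] cochain2D[OF c(2)])
qed

text \<open>As for any nonassociative bilinear product, the twelve terms of the alternated
  associator are those of the Jacobi expression of the commutator.\<close>

lemma alternation_associator:
  assumes c: "cochain2 scale \<pi>1"
  defines "B \<equiv> \<lambda>p q. \<pi>1 p q - \<pi>1 q p"
  shows "alternation (associator \<pi>1 \<pi>1) p q r = B (B p q) r + B (B q r) p + B (B r p) q"
  by (simp add: B_def alternation_def associator_def cochain2D[OF c] algebra_simps)

text \<open>Moving \<open>r\<close> through the pair \<open>p\<close>, \<open>q\<close> and adding
  the three cocycle identities with the signs of these shuffles leaves only commutators.\<close>

lemma antisymmetrised_derivation:
  assumes c: "cochain2 scale \<pi>1" and z: "hochschild2 \<pi>1 = (\<lambda>p q r. 0)"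
  defines "B \<equiv> \<lambda>p q. \<pi>1 p q - \<pi>1 q p"
  shows "B (p * q) r = p * B q r + B p r * q"
proof -
  have "p * B q r + B p r * q - B (p * q) r
      = hochschild2 \<pi>1 p q r - hochschild2 \<pi>1 p r q + hochschild2 \<pi>1 r p q"
    by (simp add: B_def coboundary2_def algebra_simps)
  then show ?thesis by (simp add: z)
qed

lemma antisym_part_poisson:
  assumes "deformation scale [\<pi>1, \<pi>2]"
  shows "poisson_bracket scale (antisym_part scale \<pi>1)"
proof -
  have c: "cochain2 scale \<pi>1" and z: "hochschild2 \<pi>1 = (\<lambda>p q r. 0)"
    and z2: "hochschild2 \<pi>2 = associator \<pi>1 \<pi>1"
    using assms by (simp_all add: deformation2_iff deformation1_iff)
  define B where "B p q = \<pi>1 p q - \<pi>1 q p" for p q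
  let ?A = "antisym_part scale \<pi>1"
  have A: "?A = (\<lambda>p q. scale (1/2) (B p q))"
    by (simp add: antisym_part_def B_def)
  have B_anti: "B q p = - B p q" for p q
    by (simp add: B_def)
  have B: "cochain2 scale B"
    by (rule cochain2I) (simp_all add: B_def cochain2D[OF c] scale_right_diff_distrib)
  have B_der: "B (p * q) r = p * B q r + B p r * q" for p q r
    using antisymmetrised_derivation[OF c z] by (simp add: B_def)
  have B_jac: "B (B p q) r + B (B q r) p + B (B r p) q = 0" for p q r
    using alternation_associator[OF c, of p q r] hochschild.alternation_coboundary2[of \<pi>2 p q r]
    by (simp add: B_def z2)
  have anti: "?A q p = - ?A p q" for p q
    by (simp add: A B_anti[of q p])
  have der: "?A (p * q) r = p * ?A q r + ?A p r * q" for p q r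
    by (simp add: A B_der scale_right_distrib scale_mult_left scale_mult_right)
  have "?A r (p * q) = p * ?A r q + ?A r p * q" for p q r
    by (simp add: anti[of r "p * q"] anti[of r p] anti[of r q] der)
  moreover have "cochain2 scale ?A"
    by (rule cochain2I) (simp_all add: A cochain2D[OF B] scale_right_distrib mult.commute)
  moreover have "?A (?A p q) r + ?A (?A q r) p + ?A (?A r p) q = 0" for p q r
    by (simp only: A cochain2D[OF B] B_jac scale_zero_right flip: scale_right_distrib)
  ultimately show ?thesis
    using anti der unfolding poisson_bracket_def biderivation_def antisymmetric_cochain_def jacobi_def
    by blast
qed

text \<open>Transposing \<open>g\<close> reverses the arguments of its coboundary and changes the
  sign. The symmetric part of \<open>g\<close> thus carries the part of the coboundary that is odd
  under reversal, the antisymmetric part the even one.\<close>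

lemma hochschild2_sym_part:
  "hochschild2 (sym_part scale g) p q r = scale (1/2) (hochschild2 g p q r - hochschild2 g r q p)"
  by (simp add: coboundary2_def sym_part_def scale_mult_left scale_mult_right algebra_simps
      scale_right_distrib scale_right_diff_distrib)

lemma hochschild2_antisym_part:
  "hochschild2 (antisym_part scale g) p q r = scale (1/2) (hochschild2 g p q r + hochschild2 g r q p)"
  by (simp add: coboundary2_def antisym_part_def scale_mult_left scale_mult_right algebra_simps
      scale_right_distrib scale_right_diff_distrib)

lemma cochain2_sym_part:
  assumes "cochain2 scale g"
  shows "cochain2 scale (sym_part scale g)"
  by (rule cochain2I)
    (simp_all add: sym_part_def cochain2D[OF assms] scale_right_distrib algebra_simps)

lemma cochain2_antisym_part:
  assumes "cochain2 scale g"
  shows "cochain2 scale (antisym_part scale g)"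
  by (rule cochain2I)
    (simp_all add: antisym_part_def cochain2D[OF assms] scale_right_distrib scale_right_diff_distrib algebra_simps)

end

lemma two_neq_zero:
  assumes "CHAR('f::field) \<noteq> 2"
  shows "(2::'f) \<noteq> 0"
proof
  assume "(2::'f) = 0"
  then have "of_nat 2 = (0::'f)" by simp
  then have "CHAR('f) dvd 2" by (simp only: of_nat_eq_0_iff_char_dvd)
  then have "CHAR('f) = 1 \<or> CHAR('f) = 2" by (metis prime_nat_iff two_is_prime_nat)
  with assms show False by simp
qed

section \<open>Parity of the obstructions under reversal\<close>

context comm_algebra
begin

lemma scale_half_double:
  assumes "(2::'f) \<noteq> 0"
  shows "scale (1/2) (x + x) = x" "scale (1/2) x + scale (1/2) x = x"
proof -
  have "scale (1/2) x + scale (1/2) x = scale (1/2 + 1/2) x"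
    by (simp only: scale_left_distrib)
  also have "1/2 + 1/2 = (1::'f)" using assms by (simp add: field_simps)
  finally show "scale (1/2) x + scale (1/2) x = x" by simp
  then show "scale (1/2) (x + x) = x" by (simp only: scale_right_distrib)
qed

text \<open>Two uses of antisymmetry, inner and outer, make reversal exchange the two bracketings
  without further sign.\<close>

lemma associator_reversal:
  assumes "antisymmetric_cochain \<pi>1" "cochain2 scale \<pi>1"
  shows "associator \<pi>1 \<pi>1 r q p = - associator \<pi>1 \<pi>1 p q r"
proof -
  have anti: "\<pi>1 q p = - \<pi>1 p q" for p q
    using assms(1) unfolding antisymmetric_cochain_def by blast
  show ?thesis
    unfolding associator_def
    by (simp add: anti[of p "\<pi>1 r q"] anti[of "\<pi>1 q p" r] anti[of q r] anti[of p q] cochain2D[OF assms(2)])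
qed

text \<open>Each composition has one symmetric and one antisymmetric factor, so a single sign
  appears and compensates the exchange of bracketings.\<close>

lemma obstruction3_reversal:
  assumes "antisymmetric_cochain \<pi>1" "symmetric_cochain \<pi>2" "cochain2 scale \<pi>2"
  shows "obstruction3 \<pi>1 \<pi>2 r q p = obstruction3 \<pi>1 \<pi>2 p q r"
proof -
  have anti: "\<pi>1 q p = - \<pi>1 p q" for p q
    using assms(1) unfolding antisymmetric_cochain_def by blast
  have sym: "\<pi>2 q p = \<pi>2 p q" for p q
    using assms(2) by (simp add: symmetric_cochain_def)
  show ?thesis
    unfolding obstruction3_def associator_def
    by (simp add: anti[of p "\<pi>2 r q"] anti[of "\<pi>2 q p" r] sym[of q r] sym[of p q]
        anti[of q r] anti[of p q] sym[of "\<pi>1 _ _" r] sym[of p "\<pi>1 _ _"] cochain2D[OF assms(3)])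
qed

text \<open>The obstruction is odd under reversal, so averaging \<open>\<pi>2\<close> with its
  transpose preserves the equation.\<close>

lemma symmetric_second_order:
  assumes "(2::'f) \<noteq> 0" "deformation scale [\<pi>1, \<pi>2]" "antisymmetric_cochain \<pi>1"
  shows "symmetric_cochain (sym_part scale \<pi>2) \<and> deformation scale [\<pi>1, sym_part scale \<pi>2]"
proof
  have d1: "deformation scale [\<pi>1]" and c: "cochain2 scale \<pi>1" and c2: "cochain2 scale \<pi>2"
    and z2: "hochschild2 \<pi>2 = associator \<pi>1 \<pi>1"
    using assms(2) by (simp_all add: deformation2_iff deformation1_iff)
  show "symmetric_cochain (sym_part scale \<pi>2)"
    by (simp add: symmetric_cochain_def sym_part_def add.commute)
  have "hochschild2 (sym_part scale \<pi>2) p q r = associator \<pi>1 \<pi>1 p q r" for p q r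
    unfolding hochschild2_sym_part z2 associator_reversal[OF assms(3) c, of r q p]
    using scale_half_double[OF assms(1)] by simp
  then show "deformation scale [\<pi>1, sym_part scale \<pi>2]"
    using d1 cochain2_sym_part[OF c2] by (simp add: deformation2_iff fun_eq_iff)
qed

end

section \<open>Extending deformations of polynomial algebras\<close>

context monomial_basis
begin

lemma extend_second_order:
  assumes "(2::'f) \<noteq> 0" "deformation scale [\<pi>1]" "jacobi (antisym_part scale \<pi>1)"
  shows "\<exists>\<pi>2. deformation scale [\<pi>1, \<pi>2]"
proof -
  have c: "cochain2 scale \<pi>1" and z: "hochschild2 \<pi>1 = (\<lambda>p q r. 0)"
    using assms(2) by (simp_all add: deformation1_iff)
  let ?A = "antisym_part scale \<pi>1"
  have A: "\<pi>1 p q - \<pi>1 q p = ?A p q + ?A p q" for p q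
    by (simp add: antisym_part_def scale_half_double[OF assms(1)])
  define J where "J p q r = ?A (?A p q) r + ?A (?A q r) p + ?A (?A r p) q" for p q r
  \<comment> \<open>The commutator is twice \<open>?A\<close> and the Jacobi expression is
    quadratic, hence four copies, written as a sum because the class has no unit.\<close>
  have "alternation (associator \<pi>1 \<pi>1) p q r = J p q r + J p q r + (J p q r + J p q r)" for p q r
    unfolding alternation_associator[OF c] A cochain2D[OF cochain2_antisym_part[OF c]]
    by (simp add: J_def ac_simps)
  then have "alternation (associator \<pi>1 \<pi>1) p q r = 0" for p q r
    using assms(3) by (simp add: J_def jacobi_def)
  from hochschild_coboundary[OF cochain3_associator[OF c c] cocycle3_associator[OF c z] this]
  obtain g where "cochain2 scale g" "associator \<pi>1 \<pi>1 = hochschild2 g" by blast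
  then show ?thesis using assms(2) by (auto simp: deformation2_iff)
qed

text \<open>Reversal invariance of the obstruction makes its alternation vanish, and also allows the
  solution to be replaced by its antisymmetric part, the parity that a quantization
  requires.\<close>

lemma extend_third_order:
  assumes "(2::'f) \<noteq> 0" "deformation scale [\<pi>1, \<pi>2]" "antisymmetric_cochain \<pi>1" "symmetric_cochain \<pi>2"
  shows "\<exists>\<pi>3. antisymmetric_cochain \<pi>3 \<and> deformation scale [\<pi>1, \<pi>2, \<pi>3]"
proof -
  have c: "cochain2 scale \<pi>1" "cochain2 scale \<pi>2" and z: "hochschild2 \<pi>1 = (\<lambda>p q r. 0)"
    and z2: "hochschild2 \<pi>2 = associator \<pi>1 \<pi>1"
    using assms(2) by (simp_all add: deformation2_iff deformation1_iff)
  note rev = obstruction3_reversal[OF assms(3,4) c(2)]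
  obtain g where g: "cochain2 scale g" "obstruction3 \<pi>1 \<pi>2 = hochschild2 g"
    using hochschild_coboundary[OF cochain3_obstruction3[OF c] cocycle3_obstruction3[OF c z z2]
        alternation_reversal_invariant[OF rev]] by blast
  have "hochschild2 (antisym_part scale g) p q r = obstruction3 \<pi>1 \<pi>2 p q r" for p q r
    unfolding hochschild2_antisym_part g(2)[symmetric] rev[of p q r]
    by (rule scale_half_double[OF assms(1)])
  then have "deformation scale [\<pi>1, \<pi>2, antisym_part scale g]"
    using assms(2) cochain2_antisym_part[OF g(1)] by (simp add: deformation3_iff fun_eq_iff)
  moreover have "antisymmetric_cochain (antisym_part scale g)"
    by (simp add: antisymmetric_cochain_def antisym_part_def flip: scale_minus_right)
  ultimately show ?thesis by blast
qed

lemma poisson_quantization: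
  assumes "(2::'f) \<noteq> 0" "poisson_bracket scale B"
  shows "\<exists>\<pi>2 \<pi>3. deformation_quantization scale [\<lambda>p q. scale (1/2) (B p q), \<pi>2, \<pi>3]"
proof -
  let ?\<pi> = "\<lambda>p q. scale (1/2) (B p q)"
  have B: "cochain2 scale B" and anti: "\<And>p q. B q p = - B p q" and jac: "jacobi B"
    and der: "\<And>p q r. B (p * q) r = p * B q r + B p r * q" "\<And>p q r. B r (p * q) = p * B r q + B r p * q"
    using assms(2) unfolding poisson_bracket_def biderivation_def antisymmetric_cochain_def by blast+
  have c: "cochain2 scale ?\<pi>"
    by (rule cochain2I) (simp_all add: cochain2D[OF B] scale_right_distrib mult.commute)
  have a: "antisymmetric_cochain ?\<pi>"
    unfolding antisymmetric_cochain_def using anti by (metis scale_minus_right)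
  \<comment> \<open>A biderivation is a Hochschild cocycle, as the two Leibniz rules cancel all
    terms in pairs.\<close>
  have "hochschild2 ?\<pi> p q r = 0" for p q r
    by (simp add: coboundary2_def der scale_mult_left scale_mult_right scale_right_distrib algebra_simps)
  with c have d: "deformation scale [?\<pi>]"
    by (simp add: deformation1_iff fun_eq_iff)
  \<comment> \<open>The Jacobi condition required by \<open>extend_second_order\<close> thereby
    concerns \<open>?\<pi>\<close> itself and is that of \<open>B\<close> up to the factor
    1/4.\<close>
  have "antisym_part scale ?\<pi> p q = ?\<pi> p q" for p q
    by (simp add: antisym_part_def anti[of q p] scale_half_double[OF assms(1)])
  then have "antisym_part scale ?\<pi> = ?\<pi>" by (simp add: fun_eq_iff)
  moreover have "jacobi ?\<pi>"
    using jac by (simp add: jacobi_def cochain2D[OF B] flip: scale_right_distrib)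
  ultimately obtain \<pi>2 where "deformation scale [?\<pi>, \<pi>2]"
    using extend_second_order[OF assms(1) d] by auto
  then obtain \<pi>2 where 2: "symmetric_cochain \<pi>2" "deformation scale [?\<pi>, \<pi>2]"
    using symmetric_second_order[OF assms(1) _ a] by blast
  then obtain \<pi>3 where 3: "antisymmetric_cochain \<pi>3" "deformation scale [?\<pi>, \<pi>2, \<pi>3]"
    using extend_third_order[OF assms(1) _ a] by blast
  have "k = 1 \<or> k = 2 \<or> k = 3" if "k \<in> {1..length [?\<pi>, \<pi>2, \<pi>3]}" for k
    using that by auto
  then have "deformation_quantization scale [?\<pi>, \<pi>2, \<pi>3]"
    unfolding deformation_quantization_def using 2 3 a by fastforce
  then show ?thesis by blast
qed

end

theorem theorem3p5:
  fixes scale :: "'f::field \<Rightarrow> 'a::comm_ring \<Rightarrow> 'a"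
  assumes "CHAR('f) \<noteq> 2"
    and "comm_algebra scale"
  shows
    "(\<forall>\<pi>1. deformation scale [\<pi>1] \<and> extends_to_order scale [\<pi>1] 2 \<longrightarrow>
        antisymmetric_cochain (antisym_part scale \<pi>1) \<and>
        biderivation scale (antisym_part scale \<pi>1) \<and>
        jacobi (antisym_part scale \<pi>1) \<and>
        poisson_bracket scale (antisym_part scale \<pi>1))
     \<and>
     (\<forall>I :: 'i set. polynomial_algebra scale I \<longrightarrow>
        (\<forall>\<pi>1. deformation scale [\<pi>1] \<and> jacobi (antisym_part scale \<pi>1) \<longrightarrow>
           extends_to_order scale [\<pi>1] 2 \<and>
           (antisymmetric_cochain \<pi>1 \<longrightarrow>
              (\<exists>\<pi>2. symmetric_cochain \<pi>2 \<and> deformation scale [\<pi>1, \<pi>2]) \<and>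
              (\<forall>\<pi>2. symmetric_cochain \<pi>2 \<and> deformation scale [\<pi>1, \<pi>2] \<longrightarrow>
                 extends_to_order scale [\<pi>1, \<pi>2] 3))) \<and>
        (\<forall>B. poisson_bracket scale B \<longrightarrow>
           (\<exists>\<pi>2 \<pi>3. deformation_quantization scale
              [\<lambda>p q. scale (1/2) (B p q), \<pi>2, \<pi>3])))"
proof (intro conjI allI impI)
  interpret comm_algebra scale by fact
  have two: "(2::'f) \<noteq> 0" using assms(1) by (rule two_neq_zero)
  have extends1: "extends_to_order scale [\<pi>1] 2 \<longleftrightarrow> (\<exists>\<pi>2. deformation scale [\<pi>1, \<pi>2])" for \<pi>1
    by (auto simp: extends_to_order_def length_Suc_conv numeral_2_eq_2)
  have extends2: "extends_to_order scale [\<pi>1, \<pi>2] 3 \<longleftrightarrow> (\<exists>\<pi>3. deformation scale [\<pi>1, \<pi>2, \<pi>3])" for \<pi>1 \<pi>2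
    by (auto simp: extends_to_order_def length_Suc_conv numeral_3_eq_3)
  {
    fix \<pi>1
    assume "deformation scale [\<pi>1] \<and> extends_to_order scale [\<pi>1] 2"
    then show "poisson_bracket scale (antisym_part scale \<pi>1)"
      using antisym_part_poisson by (auto simp: extends1)
    then show "antisymmetric_cochain (antisym_part scale \<pi>1)"
      "biderivation scale (antisym_part scale \<pi>1)" "jacobi (antisym_part scale \<pi>1)"
      by (simp_all add: poisson_bracket_def)
  }
  fix I :: "'i set"
  assume "polynomial_algebra scale I"
  then obtain X where "monomial_basis scale X {b. set_mset b \<subseteq> I}"
    using polynomial_algebra_monomial_basis by blast
  then interpret monomial_basis scale X "{b. set_mset b \<subseteq> I}" .
  {
    fix \<pi>1
    assume d: "deformation scale [\<pi>1] \<and> jacobi (antisym_part scale \<pi>1)"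
    then obtain \<pi>2 where 2: "deformation scale [\<pi>1, \<pi>2]"
      using extend_second_order[OF two] by blast
    then show "extends_to_order scale [\<pi>1] 2" by (auto simp: extends1)
    assume a: "antisymmetric_cochain \<pi>1"
    show "\<exists>\<pi>2. symmetric_cochain \<pi>2 \<and> deformation scale [\<pi>1, \<pi>2]"
      using symmetric_second_order[OF two 2 a] by blast
    fix \<pi>2
    assume "symmetric_cochain \<pi>2 \<and> deformation scale [\<pi>1, \<pi>2]"
    then show "extends_to_order scale [\<pi>1, \<pi>2] 3"
      using extend_third_order[OF two _ a] by (auto simp: extends2)
  }
  show "\<exists>\<pi>2 \<pi>3. deformation_quantization scale [\<lambda>p q. scale (1/2) (B p q), \<pi>2, \<pi>3]"
    if "poisson_bracket scale B" for B
    using two that by (rule poisson_quantization)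
qed

end
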